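(* Fix a scenario $s$, a reference trip $(\ell,t)$ and binary first-stage decisions. The subpath-based second-stage formulation of the Microtransit Network Design (MiND) model defines an equivalent mixed-integer model to the compact second-stage formulation (each optimal solution of one yields a feasible solution of the other with the same objective value), with a tighter linear relaxation (the optimal value of the linear relaxation of the subpath-based formulation is at least that of the compact formulation). Both formulations are given in the context.
   Context: The indices $\ell,t,s$ are fixed and dropped. First-stage decisions: $x\in\{0,1\}$ (whether the trip is operated) and $z_p\in\{0,1\}$ (whether request $p$ is assigned to it). **Data.** $N$: stations of the line, within a distance $\Delta$ of the reference line. Checkpoints $\mathcal I=(i_1,\dots,i_I)$, in order along the line, with scheduled times $T(i)$; the line starts at $o=i_1$ and ends at $d=i_I$. $N^-_i$ (resp. $N^+_i$): locations that can be visited immediately after (resp. before) $i$. $tt_{ij}$: travel time from $i$ to $j$. $C$: vehicle capacity. $K$: maximum number of consecutive checkpoints that may be skipped. $\mathcal P$: passenger requests. Request $p$ has $D_p$ passengers, requested time $\tau^{req}_p$, possible pickup locations $N^{pick}_p$ (within walking limit $\Omega$ of its origin), walking time $\tau^{walk}_{ip}$ to location $i$, direct trip time $\tau^{dir}_p$, lateness $\tau^{late}_p$ and earliness $\tau^{early}_p$ at the destination, and planned departure time $t^0_p$ (when $p$ would start walking to the nearest checkpoint without deviations). $\Psi$: waiting limit. $\tau^{drop}$: drop-off time of the trip at the destination. $\lambda,\mu,\sigma,\delta\ge0$: weights; $M$: a large reward per pickup. Request $p$ is *compatible* with the trip if its scheduled arrival time at the final checkpoint is within a tolerance $\alpha$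 of $\tau_p^{req}$. **Compact formulation.** Variables: binary $v_i$ ($i\in\mathcal I$: checkpoint $i$ is visited), $y_{ij}$ ($i,j\in N$: the vehicle travels from $i$ to $j$), $w_{pi}$ ($p$ is picked up at $i$); $t^{stop}_i\ge0$ (stop time at $i$) and $t^{pick}_p\ge0$ (pickup time of $p$). With sums over $i\in N_p^{pick}$, minimize $$\sum_{p\in\mathcal P}D_p\Big(\lambda\sum_i\tau^{walk}_{ip}w_{pi}+\mu\big(t^{pick}_p-\sum_i(\tau^{req}_p+\tau^{walk}_{ip})w_{pi}\big)+\tfrac{\sigma}{\tau^{dir}_p}\big(\tau^{drop}\sum_iw_{pi}-t^{pick}_p\big)+\big(\delta\tfrac{\tau^{late}_p}{\tau^{dir}_p}+\tfrac\delta2\tfrac{\tau^{early}_p}{\tau^{dir}_p}\big)\sum_iw_{pi}-M\sum_iw_{pi}\Big)$$ subject to, with big-M parameters $M^{stop},M^T,M^y$: - $\sum_{j\in N^-_i}y_{ij}-\sum_{j\in N^+_i}y_{ji}=x$ if $i=o$, $-x$ if $i=d$, $0$ otherwise, for $i\in N$; - $t^{stop}_j\ge t^{stop}_i+tt_{ij}-M^{stop}(1-y_{ij})$ for $i\in N$, $j\in N^-_i$; - $\sum_{i\in N^{pick}_p}w_{pi}\le z_p$ for $p\in\mathcal P$; - $\sum_{p\in\mathcal P}\sum_{i\in N^{pick}_p}D_pw_{pi}\le Cx$; - $t^{pick}_p\ge t^{stop}_i-M^{stop}(1-w_{pi})$ for $p\in\mathcal P$, $i\in N$; - $w_{pi}\le\sum_{j\in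 N^-_i}y_{ij}+\sum_{j\in N^+_i}y_{ji}$ for $p\in\mathcal P$, $i\in N^{pick}_p$; - $T(i)-M^T(1-v_i)\le t^{stop}_i\le T(i)+M^T(1-v_i)$ for $i\in\mathcal I$; - $t^{stop}_i\le M^y\big(\sum_{j\in N^-_i}y_{ij}+\sum_{j\in N^+_i}y_{ji}\big)$ for $i\in N$; - $\sum_{j\in N^-_i}y_{ij}+\sum_{j\in N^+_i}y_{ji}\ge v_i$ for $i\in\mathcal I$; - $\sum_{j=i}^{i+K}v_{i_j}\ge x$ for $i=1,\dots,I-K$. **Subpath-based formulation.** A subpath $r$ is identified by a starting checkpoint $u_r$, an ending checkpoint $v_r$, and the set $\mathcal P_r\subseteq\mathcal P$ of requests served in between. Its route is a sequence of stops (location-time pairs) $(k^1,t^1),\dots,(k^H,t^H)$ with $k^1=u_r$, $k^H=v_r$, where travel between consecutive stops takes the travel time ($t^{h+1}=t^h+tt_{k^hk^{h+1}}$; stops at checkpoints occur at their scheduled times $T(\cdot)$, so the vehicle reaches $v_r$ no later than $T(v_r)$, which is its stop time there). The set of subpaths includes all subpaths such that (i) the distance to the reference line never exceeds $\Delta$; (ii) $\sum_{p\in\mathcal P_r}D_p\le C$; (iii) the travel time does not exceed $T(v_r)-T(u_r)$; (iv) up to $K$ checkpoints are skipped. A pickup of $p$ at location $i$ at time $\bar t$ is acceptable only if $t^0_p+\tau^{walk}_{ip}\le\bar t\le t^0_p+\tau^{walk}_{ip}+\Psi$ and $\tau^{walk}_{ip}\le\Omega$. The load-expanded network has nodes $(k,c)$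 with $k$ a checkpoint and load $c\in\{0,\dots,C\}$, a source (the start at checkpoint $i_1$, at time $T(i_1)$, with load $0$), and a sink. Its arcs are: for each subpath $r$, all arcs $a$ from $(u_r,c)$ to $(v_r,c')$ with $c'-c=\sum_{p\in\mathcal P_r}D_p$ (write $r(a)=r$), of cost $$g_a=\sum_{p\in\mathcal P_r}D_p\Big(\lambda\tau^{walk}_{rp}+\mu\tau^{wait}_{rp}+\sigma\tfrac{\tau^{travel}_{rp}}{\tau_p^{dir}}+\delta\tfrac{\tau^{late}_p}{\tau^{dir}_p}+\tfrac{\delta}{2}\tfrac{\tau^{early}_p}{\tau^{dir}_p}-M\Big),$$ where, if $p$ is picked up by $r$ at location $i$ at time $\tau$, the walking, waiting and in-vehicle times are $\tau^{walk}_{rp}=\tau^{walk}_{ip}$, $\tau^{wait}_{rp}=\tau-\tau^{req}_p-\tau^{walk}_{ip}$, $\tau^{travel}_{rp}=\tau^{drop}-\tau$; and terminating arcs from the nodes at the final checkpoint to the sink, of cost $0$. With binary variables $y_a$ for all arcs, minimize $\sum_ag_ay_a$ subject to flow balance (outflow minus inflow equals $x$ at the source, $-x$ at the sink, $0$ at all other nodes) and $\sum_{a:p\in\mathcal P_{r(a)}}y_a\le z_p$ for every compatible request $p$. **Standing assumption.** The trip visits each stop at most once in the scenario. The linear relaxations drop the integrality of the binary variables.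
   Formalization: In the equivalence, compact solutions must also keep scheduled times at visited checkpoints, not idle before other stops, and respect acceptable pickup windows; only compatible requests may have z_p=1 or be served by subpaths; every trip of the network is assumed to visit each stop at most once. *)

theory Defs
  imports Complex_Main "HOL-Library.Extended_Real"
begin

section \<open>Second-stage data\<close>

text \<open>
  One scenario and one reference trip are fixed, so no field carries a scenario, line or trip index.
  A pair \<open>(i, j)\<close> in \<open>legs\<close> says that \<open>j\<close> can be visited immediately after \<open>i\<close>; both neighbour sets
  \<open>N\<^sup>-\<close> and \<open>N\<^sup>+\<close> are read off this relation.
\<close>

record ('l, 'p) trip_data =
  stations :: "'l set"
  ref_dist :: "'l \<Rightarrow> real"
  max_dist :: real
  checkpoints :: "'l list"
  sched :: "'l \<Rightarrow> real"
  legs :: "('l \<times> 'l) set"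
  tt :: "'l \<Rightarrow> 'l \<Rightarrow> real"
  capacity :: nat
  max_skip :: nat
  requests :: "'p set"
  passengers :: "'p \<Rightarrow> nat"
  t_req :: "'p \<Rightarrow> real"
  pick_locs :: "'p \<Rightarrow> 'l set"
  t_walk :: "'l \<Rightarrow> 'p \<Rightarrow> real"
  walk_limit :: real
  t_dir :: "'p \<Rightarrow> real"
  t_late :: "'p \<Rightarrow> real"
  t_early :: "'p \<Rightarrow> real"
  t_depart :: "'p \<Rightarrow> real"
  wait_limit :: real
  t_drop :: real
  arrival_tol :: real
  w_walk :: real
  w_wait :: real
  w_travel :: real
  w_delay :: real
  reward :: real
  M_stop :: real
  M_T :: real
  M_y :: real

definition origin :: "('l, 'p) trip_data \<Rightarrow> 'l" where
  "origin D = hd (checkpoints D)"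

definition destination :: "('l, 'p) trip_data \<Rightarrow> 'l" where
  "destination D = last (checkpoints D)"

definition next_locs :: "('l, 'p) trip_data \<Rightarrow> 'l \<Rightarrow> 'l set" where
  "next_locs D i = {j \<in> stations D. (i, j) \<in> legs D}"

definition prev_locs :: "('l, 'p) trip_data \<Rightarrow> 'l \<Rightarrow> 'l set" where
  "prev_locs D i = {j \<in> stations D. (j, i) \<in> legs D}"

definition compatible :: "('l, 'p) trip_data \<Rightarrow> 'p \<Rightarrow> bool" where
  "compatible D p \<longleftrightarrow> \<bar>sched D (destination D) - t_req D p\<bar> \<le> arrival_tol D"

definition acceptable :: "('l, 'p) trip_data \<Rightarrow> 'p \<Rightarrow> 'l \<Rightarrow> real \<Rightarrow> bool" where
  "acceptable D p i t \<longleftrightarrow>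
     t_depart D p + t_walk D i p \<le> t \<and>
     t \<le> t_depart D p + t_walk D i p + wait_limit D \<and>
     t_walk D i p \<le> walk_limit D"

definition valid_data :: "('l, 'p) trip_data \<Rightarrow> bool" where
  "valid_data D \<longleftrightarrow>
     finite (stations D) \<and> (\<forall>i\<in>stations D. ref_dist D i \<le> max_dist D) \<and>
     2 \<le> length (checkpoints D) \<and> set (checkpoints D) \<subseteq> stations D \<and>
     sorted_wrt (\<lambda>i j. sched D i < sched D j) (checkpoints D) \<and> 0 \<le> sched D (origin D) \<and>
     legs D \<subseteq> stations D \<times> stations D \<and> (\<forall>(i, j)\<in>legs D. 0 < tt D i j) \<and>
     finite (requests D) \<and>
     (\<forall>p\<in>requests D. pick_locs D p \<subseteq> {i \<in> stations D. t_walk D i p \<le> walk_limit D}) \<and>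
     (\<forall>p\<in>requests D. 0 < t_dir D p) \<and>
     0 \<le> w_walk D \<and> 0 \<le> w_wait D \<and> 0 \<le> w_travel D \<and> 0 \<le> w_delay D"

text \<open>
  The big-M parameters only have to be large enough not to cut off a trip that runs within
  the schedule, whose stop times lie between \<open>0\<close> and the scheduled time of the destination.
\<close>

definition valid_big_M :: "('l, 'p) trip_data \<Rightarrow> bool" where
  "valid_big_M D \<longleftrightarrow>
     sched D (destination D) \<le> M_stop D \<and>
     (\<forall>(i, j)\<in>legs D. sched D (destination D) + tt D i j \<le> M_stop D) \<and>
     sched D (destination D) \<le> M_T D \<and>
     sched D (destination D) \<le> M_y D"

text \<open>A request can be assigned by the first stage only to a trip with which it is compatible.\<close>

definition first_stage :: "('l, 'p) trip_data \<Rightarrow> real \<Rightarrow> ('p \<Rightarrow> real) \<Rightarrow> bool" where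
  "first_stage D x z \<longleftrightarrow>
     x \<in> {0, 1} \<and> (\<forall>p\<in>requests D. z p \<in> {0, 1} \<and> (z p = 1 \<longrightarrow> compatible D p))"


section \<open>Compact formulation\<close>

record ('l, 'p) compact_vars =
  cv :: "'l \<Rightarrow> real"
  cy :: "'l \<Rightarrow> 'l \<Rightarrow> real"
  cw :: "'p \<Rightarrow> 'l \<Rightarrow> real"
  t_stop :: "'l \<Rightarrow> real"
  t_pick :: "'p \<Rightarrow> real"

definition throughput :: "('l, 'p) trip_data \<Rightarrow> ('l, 'p) compact_vars \<Rightarrow> 'l \<Rightarrow> real" where
  "throughput D S i = (\<Sum>j\<in>next_locs D i. cy S i j) + (\<Sum>j\<in>prev_locs D i. cy S j i)"

definition compact_cost :: "('l, 'p) trip_data \<Rightarrow> ('l, 'p) compact_vars \<Rightarrow> real" where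
  "compact_cost D S = (\<Sum>p\<in>requests D. real (passengers D p) *
     (w_walk D * (\<Sum>i\<in>pick_locs D p. t_walk D i p * cw S p i)
      + w_wait D * (t_pick S p - (\<Sum>i\<in>pick_locs D p. (t_req D p + t_walk D i p) * cw S p i))
      + w_travel D / t_dir D p * (t_drop D * (\<Sum>i\<in>pick_locs D p. cw S p i) - t_pick S p)
      + (w_delay D * (t_late D p / t_dir D p) + w_delay D / 2 * (t_early D p / t_dir D p))
          * (\<Sum>i\<in>pick_locs D p. cw S p i)
      - reward D * (\<Sum>i\<in>pick_locs D p. cw S p i)))"

definition compact_constraints ::
  "('l, 'p) trip_data \<Rightarrow> real \<Rightarrow> ('p \<Rightarrow> real) \<Rightarrow> ('l, 'p) compact_vars \<Rightarrow> bool" where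
  "compact_constraints D x z S \<longleftrightarrow>
     (\<forall>i\<in>stations D. (\<Sum>j\<in>next_locs D i. cy S i j) - (\<Sum>j\<in>prev_locs D i. cy S j i) =
        (if i = origin D then x else if i = destination D then - x else 0)) \<and>
     (\<forall>i\<in>stations D. \<forall>j\<in>next_locs D i.
        t_stop S j \<ge> t_stop S i + tt D i j - M_stop D * (1 - cy S i j)) \<and>
     (\<forall>p\<in>requests D. (\<Sum>i\<in>pick_locs D p. cw S p i) \<le> z p) \<and>
     (\<Sum>p\<in>requests D. \<Sum>i\<in>pick_locs D p. real (passengers D p) * cw S p i) \<le> real (capacity D) * x \<and>
     (\<forall>p\<in>requests D. \<forall>i\<in>stations D. t_pick S p \<ge> t_stop S i - M_stop D * (1 - cw S p i)) \<and>
     (\<forall>p\<in>requests D. \<forall>i\<in>pick_locs D p. cw S p i \<le> throughput D S i) \<and>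
     (\<forall>i\<in>set (checkpoints D).
        sched D i - M_T D * (1 - cv S i) \<le> t_stop S i \<and>
        t_stop S i \<le> sched D i + M_T D * (1 - cv S i)) \<and>
     (\<forall>i\<in>stations D. t_stop S i \<le> M_y D * throughput D S i) \<and>
     (\<forall>i\<in>set (checkpoints D). throughput D S i \<ge> cv S i) \<and>
     (\<forall>n. n + max_skip D < length (checkpoints D) \<longrightarrow>
        (\<Sum>m = n..n + max_skip D. cv S (checkpoints D ! m)) \<ge> x) \<and>
     (\<forall>i\<in>stations D. t_stop S i \<ge> 0) \<and>
     (\<forall>p\<in>requests D. t_pick S p \<ge> 0)"

definition compact_domain ::
  "('l, 'p) trip_data \<Rightarrow> real set \<Rightarrow> ('l, 'p) compact_vars \<Rightarrow> bool" where
  "compact_domain D B S \<longleftrightarrow>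
     (\<forall>i\<in>set (checkpoints D). cv S i \<in> B) \<and>
     (\<forall>i\<in>stations D. \<forall>j\<in>stations D. cy S i j \<in> B) \<and>
     (\<forall>p\<in>requests D. \<forall>i\<in>stations D. cw S p i \<in> B)"

definition compact_feasible ::
  "('l, 'p) trip_data \<Rightarrow> real \<Rightarrow> ('p \<Rightarrow> real) \<Rightarrow> ('l, 'p) compact_vars \<Rightarrow> bool" where
  "compact_feasible D x z S \<longleftrightarrow> compact_constraints D x z S \<and> compact_domain D {0, 1} S"

definition compact_lp_feasible ::
  "('l, 'p) trip_data \<Rightarrow> real \<Rightarrow> ('p \<Rightarrow> real) \<Rightarrow> ('l, 'p) compact_vars \<Rightarrow> bool" where
  "compact_lp_feasible D x z S \<longleftrightarrow> compact_constraints D x z S \<and> compact_domain D {0..1} S"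

definition compact_lp_value :: "('l, 'p) trip_data \<Rightarrow> real \<Rightarrow> ('p \<Rightarrow> real) \<Rightarrow> ereal" where
  "compact_lp_value D x z = (INF S\<in>{S. compact_lp_feasible D x z S}. ereal (compact_cost D S))"

text \<open>
  The operating rules of a trip. The subpaths below obey them by construction, but the constraints
  above do not enforce them: with \<open>max_skip D \<ge> 1\<close> they allow \<open>cv S (origin D) = 0\<close>, and then a
  departure before the scheduled time of the origin; they also allow idling on the way to a
  non-checkpoint station, and pickups outside the acceptable time window.
\<close>

definition operating_rules :: "('l, 'p) trip_data \<Rightarrow> ('l, 'p) compact_vars \<Rightarrow> bool" where
  "operating_rules D S \<longleftrightarrow>
     (\<forall>i\<in>set (checkpoints D). throughput D S i \<ge> 1 \<longrightarrow> t_stop S i = sched D i) \<and>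
     (\<forall>i\<in>stations D. \<forall>j\<in>next_locs D i.
        j \<notin> set (checkpoints D) \<and> cy S i j = 1 \<longrightarrow> t_stop S j = t_stop S i + tt D i j) \<and>
     (\<forall>p\<in>requests D. \<forall>i\<in>pick_locs D p. cw S p i = 1 \<longrightarrow> acceptable D p i (t_stop S i))"


section \<open>Subpath-based formulation\<close>

text \<open>
  A subpath carries its route and, for every request it serves, the stop (location and time) of the
  pickup; the set of served requests is the domain of \<open>pickup\<close>. Different routes or pickup plans
  with the same endpoints and the same requests are different subpaths.
\<close>

datatype ('l, 'p) subpath =
  Subpath (route: "('l \<times> real) list") (pickup: "'p \<rightharpoonup> 'l \<times> real")

definition sp_locs :: "('l, 'p) subpath \<Rightarrow> 'l list" where
  "sp_locs r = map fst (route r)"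

definition sp_start :: "('l, 'p) subpath \<Rightarrow> 'l" where
  "sp_start r = hd (sp_locs r)"

definition sp_end :: "('l, 'p) subpath \<Rightarrow> 'l" where
  "sp_end r = last (sp_locs r)"

definition served :: "('l, 'p) subpath \<Rightarrow> 'p set" where
  "served r = dom (pickup r)"

definition load :: "('l, 'p) trip_data \<Rightarrow> ('l, 'p) subpath \<Rightarrow> nat" where
  "load D r = (\<Sum>p\<in>served r. passengers D p)"

definition travel_time :: "('l, 'p) trip_data \<Rightarrow> 'l list \<Rightarrow> real" where
  "travel_time D ks = (\<Sum>h<length ks - 1. tt D (ks ! h) (ks ! Suc h))"

text \<open>
  The interior stops are not checkpoints: a checkpoint between the two endpoints is skipped. The stop
  time at the ending checkpoint is its scheduled time, so the last leg may include idle time.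
\<close>

definition subpaths :: "('l, 'p) trip_data \<Rightarrow> ('l, 'p) subpath set" where
  "subpaths D = {r.
     (\<exists>a b. a < b \<and> b < length (checkpoints D) \<and> b - a - 1 \<le> max_skip D \<and>
        sp_start r = checkpoints D ! a \<and> sp_end r = checkpoints D ! b) \<and>
     2 \<le> length (route r) \<and>
     (\<forall>h. Suc h < length (route r) \<longrightarrow>
        sp_locs r ! Suc h \<in> next_locs D (sp_locs r ! h)) \<and>
     (\<forall>k\<in>set (sp_locs r). k \<in> stations D \<and> ref_dist D k \<le> max_dist D) \<and>
     (\<forall>h. 0 < h \<and> Suc h < length (route r) \<longrightarrow> sp_locs r ! h \<notin> set (checkpoints D)) \<and>
     snd (hd (route r)) = sched D (sp_start r) \<and>
     snd (last (route r)) = sched D (sp_end r) \<and>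
     (\<forall>h. Suc (Suc h) < length (route r) \<longrightarrow>
        snd (route r ! Suc h) = snd (route r ! h) + tt D (sp_locs r ! h) (sp_locs r ! Suc h)) \<and>
     travel_time D (sp_locs r) \<le> sched D (sp_end r) - sched D (sp_start r) \<and>
     served r \<subseteq> {p \<in> requests D. compatible D p} \<and>
     load D r \<le> capacity D \<and>
     (\<forall>p i t. pickup r p = Some (i, t) \<longrightarrow>
        (i, t) \<in> set (route r) \<and> i \<in> pick_locs D p \<and> acceptable D p i t)}"

definition pickup_cost :: "('l, 'p) trip_data \<Rightarrow> 'p \<Rightarrow> 'l \<times> real \<Rightarrow> real" where
  "pickup_cost D p s = (case s of (i, t) \<Rightarrow>
     w_walk D * t_walk D i p + w_wait D * (t - t_req D p - t_walk D i p)
     + w_travel D * ((t_drop D - t) / t_dir D p)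
     + w_delay D * (t_late D p / t_dir D p) + w_delay D / 2 * (t_early D p / t_dir D p)
     - reward D)"

definition subpath_cost :: "('l, 'p) trip_data \<Rightarrow> ('l, 'p) subpath \<Rightarrow> real" where
  "subpath_cost D r =
     (\<Sum>p\<in>served r. real (passengers D p) * pickup_cost D p (the (pickup r p)))"

datatype 'l node = At 'l nat | Sink

datatype ('l, 'p) arc = Travel "('l, 'p) subpath" nat nat | Terminate nat

definition nodes :: "('l, 'p) trip_data \<Rightarrow> 'l node set" where
  "nodes D = insert Sink {At k c |k c. k \<in> set (checkpoints D) \<and> c \<le> capacity D}"

definition source :: "('l, 'p) trip_data \<Rightarrow> 'l node" where
  "source D = At (origin D) 0"

definition arcs :: "('l, 'p) trip_data \<Rightarrow> ('l, 'p) arc set" where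
  "arcs D =
     {Travel r c c' |r c c'. r \<in> subpaths D \<and> c \<le> capacity D \<and> c' \<le> capacity D \<and> c' = c + load D r}
     \<union> {Terminate c |c. c \<le> capacity D}"

fun arc_tail :: "('l, 'p) trip_data \<Rightarrow> ('l, 'p) arc \<Rightarrow> 'l node" where
  "arc_tail D (Travel r c c') = At (sp_start r) c"
| "arc_tail D (Terminate c) = At (destination D) c"

fun arc_head :: "('l, 'p) trip_data \<Rightarrow> ('l, 'p) arc \<Rightarrow> 'l node" where
  "arc_head D (Travel r c c') = At (sp_end r) c'"
| "arc_head D (Terminate c) = Sink"

fun arc_served :: "('l, 'p) arc \<Rightarrow> 'p set" where
  "arc_served (Travel r c c') = served r"
| "arc_served (Terminate c) = {}"

fun arc_cost :: "('l, 'p) trip_data \<Rightarrow> ('l, 'p) arc \<Rightarrow> real" where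
  "arc_cost D (Travel r c c') = subpath_cost D r"
| "arc_cost D (Terminate c) = 0"

lemma finite_subpaths:
  assumes V: "valid_data D"
  shows "finite (subpaths D)"
proof -
  let ?N = "stations D"
  define e where "e = Min (insert 1 ((\<lambda>(i,j). tt D i j) ` legs D))"
  have fl: "finite (legs D)"
    using V unfolding valid_data_def by (meson finite_SigmaI finite_subset)
  have e0: "0 < e" unfolding e_def using fl V by (auto simp: valid_data_def)
  have e1: "e \<le> tt D i j" if "(i, j) \<in> legs D" for i j
    unfolding e_def using fl that by (intro Min_le) (auto intro!: image_eqI[of _ _ "(i,j)"])
  define W where "W = Max ((\<lambda>(i,j). sched D j - sched D i) ` (set (checkpoints D) \<times> set (checkpoints D)))"
  have W: "sched D j - sched D i \<le> W" if "i \<in> set (checkpoints D)" "j \<in> set (checkpoints D)" for i j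
    unfolding W_def using that by (intro Max_ge) (auto intro!: image_eqI[of _ _ "(i,j)"])
  define B where "B = nat \<lceil>W / e\<rceil> + 1"
  define L where "L = {ks. set ks \<subseteq> ?N \<and> length ks \<le> B}"
  have finL: "finite L" unfolding L_def using V by (intro finite_lists_length_le) (auto simp: valid_data_def)
  define tm where "tm ks = (\<lambda>h. if Suc h = length ks then sched D (last ks)
      else sched D (hd ks) + (\<Sum>m<h. tt D (ks ! m) (ks ! Suc m)))" for ks :: "'a list"
  define R where "R = (\<lambda>ks. zip ks (map (tm ks) [0..<length ks])) ` L"
  have finR: "finite R" unfolding R_def using finL by simp
  define Q where "Q = (\<Union>rt\<in>R. Subpath rt ` {m. dom m \<subseteq> requests D \<and> ran m \<subseteq> set rt})"
  have "finite Q" unfolding Q_def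
  proof (intro finite_UN_I finR finite_imageI)
    fix rt :: "('a \<times> real) list"
    have "{m. dom m \<subseteq> requests D \<and> ran m \<subseteq> set rt}
        = (\<Union>A\<in>Pow (requests D). {m. dom m = A \<and> ran m \<subseteq> set rt})" by auto
    then show "finite {m. dom m \<subseteq> requests D \<and> ran m \<subseteq> set rt}"
      using V by (auto simp: valid_data_def intro!: finite_set_of_finite_maps intro: finite_subset)
  qed
  moreover have "subpaths D \<subseteq> Q"
  proof
    fix r assume r: "r \<in> subpaths D"
    let ?ks = "sp_locs r"
    have len: "length ?ks = length (route r)" by (simp add: sp_locs_def)
    have r2: "2 \<le> length (route r)" using r by (simp add: subpaths_def)
    have ne: "route r \<noteq> []" using r2 by auto
    have legs: "(?ks ! h, ?ks ! Suc h) \<in> legs D" if "Suc h < length (route r)" for h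
      using r that by (auto simp: subpaths_def next_locs_def)
    have ends: "sp_start r \<in> set (checkpoints D)" "sp_end r \<in> set (checkpoints D)"
      using r by (auto simp: subpaths_def)
    have "real (length ?ks - 1) * e \<le> travel_time D ?ks"
      unfolding travel_time_def using sum_bounded_below[of "{..<length ?ks - 1}" e "\<lambda>h. tt D (?ks ! h) (?ks ! Suc h)"]
        e1 legs len by auto
    also have "\<dots> \<le> W" using r W[OF ends] by (auto simp: subpaths_def)
    finally have "real (length ?ks - 1) \<le> W / e" using e0 by (simp add: field_simps)
    then have "length ?ks \<le> B" unfolding B_def by linarith
    moreover have "set ?ks \<subseteq> ?N" using r by (auto simp: subpaths_def)
    ultimately have kL: "?ks \<in> L" by (simp add: L_def)
    have t1: "snd (route r ! h) = sched D (hd ?ks) + (\<Sum>m<h. tt D (?ks ! m) (?ks ! Suc m))"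
      if "Suc h < length (route r)" for h
      using that
    proof (induction h)
      case 0
      then show ?case using r ne by (auto simp: subpaths_def sp_start_def hd_conv_nth)
    next
      case (Suc h)
      then show ?case using r by (auto simp: subpaths_def)
    qed
    have t2: "snd (last (route r)) = sched D (last ?ks)"
      using r by (auto simp: subpaths_def sp_end_def)
    have "route r = zip ?ks (map (tm ?ks) [0..<length ?ks])"
    proof (rule nth_equalityI)
      fix h assume h: "h < length (route r)"
      have "snd (route r ! h) = tm ?ks h"
      proof (cases "Suc h = length (route r)")
        case True
        then have "route r ! h = last (route r)" using ne by (simp add: last_conv_nth flip: True)
        then show ?thesis using t2 True len by (simp add: tm_def)
      next
        case False
        then show ?thesis using t1[of h] h len by (simp add: tm_def)
      qed
      then show "route r ! h = zip ?ks (map (tm ?ks) [0..<length ?ks]) ! h"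
        using h len by (simp add: prod_eq_iff) (simp add: sp_locs_def)
    qed (simp add: len)
    then have "route r \<in> R" unfolding R_def using kL by blast
    moreover have "dom (pickup r) \<subseteq> requests D" using r by (auto simp: subpaths_def served_def)
    moreover have "ran (pickup r) \<subseteq> set (route r)"
    proof
      fix s assume "s \<in> ran (pickup r)"
      then obtain p where "pickup r p = Some s" by (auto simp: ran_def)
      then show "s \<in> set (route r)" using r by (cases s) (auto simp: subpaths_def)
    qed
    ultimately show "r \<in> Q" unfolding Q_def
      by (intro UN_I[of "route r"] image_eqI[of _ _ "pickup r"]) auto
  qed
  ultimately show ?thesis by (rule rev_finite_subset)
qed

lemma finite_arcs:
  assumes "valid_data D"
  shows "finite (arcs D)"
proof -
  have "arcs D \<subseteq> (\<lambda>(r, c, c'). Travel r c c') ` (subpaths D \<times> {..capacity D} \<times> {..capacity D})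
      \<union> Terminate ` {..capacity D}"
    by (auto simp: arcs_def image_iff)
  then show ?thesis
    by (rule finite_subset) (simp add: finite_subpaths[OF assms])
qed

text \<open>The sums over all arcs below are therefore sums over finite sets.\<close>

definition network_cost :: "('l, 'p) trip_data \<Rightarrow> (('l, 'p) arc \<Rightarrow> real) \<Rightarrow> real" where
  "network_cost D y = (\<Sum>a\<in>arcs D. arc_cost D a * y a)"

definition network_constraints ::
  "('l, 'p) trip_data \<Rightarrow> real \<Rightarrow> ('p \<Rightarrow> real) \<Rightarrow> (('l, 'p) arc \<Rightarrow> real) \<Rightarrow> bool" where
  "network_constraints D x z y \<longleftrightarrow>
     (\<forall>n\<in>nodes D. (\<Sum>a\<in>{a \<in> arcs D. arc_tail D a = n}. y a) - (\<Sum>a\<in>{a \<in> arcs D. arc_head D a = n}. y a) =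
        (if n = source D then x else if n = Sink then - x else 0)) \<and>
     (\<forall>p\<in>requests D. compatible D p \<longrightarrow> (\<Sum>a\<in>{a \<in> arcs D. p \<in> arc_served a}. y a) \<le> z p)"

definition network_feasible ::
  "('l, 'p) trip_data \<Rightarrow> real \<Rightarrow> ('p \<Rightarrow> real) \<Rightarrow> (('l, 'p) arc \<Rightarrow> real) \<Rightarrow> bool" where
  "network_feasible D x z y \<longleftrightarrow> network_constraints D x z y \<and> (\<forall>a\<in>arcs D. y a \<in> {0, 1})"

definition network_lp_feasible ::
  "('l, 'p) trip_data \<Rightarrow> real \<Rightarrow> ('p \<Rightarrow> real) \<Rightarrow> (('l, 'p) arc \<Rightarrow> real) \<Rightarrow> bool" where
  "network_lp_feasible D x z y \<longleftrightarrow> network_constraints D x z y \<and> (\<forall>a\<in>arcs D. y a \<in> {0..1})"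

definition network_lp_value :: "('l, 'p) trip_data \<Rightarrow> real \<Rightarrow> ('p \<Rightarrow> real) \<Rightarrow> ereal" where
  "network_lp_value D x z = (INF y\<in>{y. network_lp_feasible D x z y}. ereal (network_cost D y))"


section \<open>Every stop is visited at most once\<close>

definition is_trip :: "('l, 'p) trip_data \<Rightarrow> ('l, 'p) subpath list \<Rightarrow> bool" where
  "is_trip D rs \<longleftrightarrow>
     rs \<noteq> [] \<and> set rs \<subseteq> subpaths D \<and>
     sp_start (hd rs) = origin D \<and> sp_end (last rs) = destination D \<and>
     (\<forall>h. Suc h < length rs \<longrightarrow> sp_end (rs ! h) = sp_start (rs ! Suc h)) \<and>
     (\<Sum>r\<leftarrow>rs. load D r) \<le> capacity D"

text \<open>The checkpoint shared by two consecutive subpaths is one stop and is listed once.\<close>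

definition trip_stops :: "('l, 'p) trip_data \<Rightarrow> ('l, 'p) subpath list \<Rightarrow> 'l list" where
  "trip_stops D rs = origin D # concat (map (\<lambda>r. tl (sp_locs r)) rs)"

definition visits_once :: "('l, 'p) trip_data \<Rightarrow> bool" where
  "visits_once D \<longleftrightarrow> (\<forall>rs. is_trip D rs \<longrightarrow> distinct (trip_stops D rs))"

end

theory Submission
  imports Defs
begin

text \<open>
  The load-expanded network is acyclic, because every arc moves forward in scheduled time. A flow of
  value \<open>x\<close> from source to sink is therefore a nonnegative combination, of total weight \<open>x\<close>, of
  source-to-sink walks (\<open>flow_decomposition\<close>), and a binary flow of value \<open>1\<close> is a single walk
  (\<open>binary_flow\<close>). Such walks are exactly the trips: chains of subpaths from the origin to the
  destination whose total load respects the capacity.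

  From the network to the compact formulation: a trip induces a compact solution \<open>trip_point\<close> that
  follows its stops and copies its pickups. Because no stop is repeated, it satisfies
  every compact constraint except possibly those on the individual requests, and its cost is the sum
  of the costs of the subpaths. An integral network solution is one trip, on which the assignment
  constraints of the network bound the pickups of each request; this gives a feasible
  compact solution of equal cost. A solution of the network relaxation is a convex combination of
  trips, and the same convex combination of the points \<open>trip_point\<close> solves the compact relaxation
  with equal cost (\<open>mixture_feasible\<close>); hence the inequality between the optimal values.
  Here a single trip may serve a request twice, even at one and the same checkpoint; then the
  constraint linking pickup times to stop times can fail for that trip, and it is recovered only for
  the combination, from the bound \<open>t_pick_slack\<close>, which is linear in the amount picked up.

  From the compact formulation to the network: the leg variables of an integral compact solution form
  a binary flow on the legs, which is acyclic because stop times increase along used legs. It is one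
  walk, which is cut into subpaths at the checkpoints that it visits (\<open>split_at_checkpoints\<close>); the operating
  rules and the window constraints on skipped checkpoints are what makes every piece a subpath. The
  pickup times of the resulting trip are the stop times, whereas the compact formulation only bounds
  pickup times from below. Optimality closes this gap: since any pickup can be delayed freely, the
  objective cannot decrease in a pickup time, so the trip costs at most as much as the compact
  solution, and mapping it back to the compact formulation shows that it costs at least as much.

  If \<open>x = 0\<close>, then all flows vanish, all costs are \<open>0\<close> at the optimum, and the claims are immediate.
\<close>

section \<open>Flows in acyclic networks\<close>

text \<open>
  The list of arcs \<open>P\<close> leads from the node \<open>n\<close> to the node \<open>m\<close>, where \<open>s\<close> and \<open>t\<close> give the tail and the
  head of an arc. Arcs are arbitrary objects, so the same notion serves for legs, for arcs of the
  load-expanded network, and for chains of subpaths.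
\<close>

fun walk :: "('a \<Rightarrow> 'n) \<Rightarrow> ('a \<Rightarrow> 'n) \<Rightarrow> 'n \<Rightarrow> 'a list \<Rightarrow> 'n \<Rightarrow> bool" where
  "walk s t n [] m \<longleftrightarrow> n = m"
| "walk s t n (a # P) m \<longleftrightarrow> s a = n \<and> walk s t (t a) P m"

text \<open>
  Outflow minus inflow of \<open>f\<close> at the node \<open>n\<close>.
\<close>

definition excess :: "'a set \<Rightarrow> ('a \<Rightarrow> 'n) \<Rightarrow> ('a \<Rightarrow> 'n) \<Rightarrow> ('a \<Rightarrow> real) \<Rightarrow> 'n \<Rightarrow> real" where
  "excess E s t f n = (\<Sum>a\<in>{a \<in> E. s a = n}. f a) - (\<Sum>a\<in>{a \<in> E. t a = n}. f a)"

text \<open>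
  A nonnegative flow of value \<open>v\<close> from \<open>src\<close> to \<open>snk\<close>. Balance is required at every element of the
  node type; off the network both sums are empty.
\<close>

definition flow ::
  "'a set \<Rightarrow> ('a \<Rightarrow> 'n) \<Rightarrow> ('a \<Rightarrow> 'n) \<Rightarrow> 'n \<Rightarrow> 'n \<Rightarrow> real \<Rightarrow> ('a \<Rightarrow> real) \<Rightarrow> bool" where
  "flow E s t src snk v f \<longleftrightarrow>
     (\<forall>a\<in>E. 0 \<le> f a) \<and>
     (\<forall>n. excess E s t f n = (if n = src then v else if n = snk then - v else 0))"

text \<open>
  The potential \<open>\<phi>\<close> increases along every arc that carries flow, so the support of \<open>f\<close> is acyclic.
\<close>

definition ascending :: "'a set \<Rightarrow> ('a \<Rightarrow> 'n) \<Rightarrow> ('a \<Rightarrow> 'n) \<Rightarrow> ('n \<Rightarrow> real) \<Rightarrow> ('a \<Rightarrow> real) \<Rightarrow> bool" where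
  "ascending E s t \<phi> f \<longleftrightarrow> (\<forall>a\<in>E. 0 < f a \<longrightarrow> \<phi> (s a) < \<phi> (t a))"

lemma walk_append: "walk s t n (P @ Q) m \<longleftrightarrow> (\<exists>k. walk s t n P k \<and> walk s t k Q m)"
  by (induction P arbitrary: n) auto

lemma sum_count_list:
  assumes "finite E" "set P \<subseteq> E"
  shows "(\<Sum>a\<in>{a \<in> E. Q a}. g a * real (count_list P a)) = (\<Sum>a\<leftarrow>filter Q P. g a)"
  using assms(2)
proof (induction P)
  case (Cons b P)
  have "(\<Sum>a\<in>{a \<in> E. Q a}. g a * real (count_list (b # P) a))
      = (\<Sum>a\<in>{a \<in> E. Q a}. g a * real (count_list P a) + (if a = b then g a else 0))"
    by (intro sum.cong) (auto simp: algebra_simps)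
  also have "\<dots> = (\<Sum>a\<leftarrow>filter Q P. g a) + (if Q b then g b else 0)"
    using Cons assms(1) by (simp add: sum.distrib)
  finally show ?case by simp
qed simp

lemma sum_count_list_length:
  assumes "finite E" "set P \<subseteq> E"
  shows "(\<Sum>a\<in>{a \<in> E. Q a}. real (count_list P a)) = real (length (filter Q P))"
  using sum_count_list[OF assms, where g = "\<lambda>_. 1" and Q = Q] by (simp add: sum_list_triv)

lemma count_list_distinct: "distinct P \<Longrightarrow> count_list P a = of_bool (a \<in> set P)"
  by (induction P) auto

lemma excess_walk:
  assumes "finite E" "set P \<subseteq> E" "walk s t n P m"
  shows "excess E s t (\<lambda>a. real (count_list P a)) k = of_bool (k = n) - of_bool (k = m)"
proof -
  have "real (length (filter (\<lambda>a. s a = k) P)) - real (length (filter (\<lambda>a. t a = k) P))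
      = of_bool (k = n) - of_bool (k = m)"
    using assms(3)
  proof (induction P arbitrary: n)
    case (Cons a P)
    then have a: "s a = n" and w: "walk s t (t a) P m" by auto
    show ?case using Cons.IH[OF w] a by (auto simp: of_bool_def split: if_splits)
  qed simp
  then show ?thesis
    using assms(1,2) by (simp add: excess_def sum_count_list_length)
qed

lemma walk_distinct:
  assumes "walk s t n P m" "\<And>a. a \<in> set P \<Longrightarrow> \<phi> (s a) < (\<phi> (t a) :: real)"
  shows "distinct P \<and> (\<forall>a\<in>set P. \<phi> n \<le> \<phi> (s a) \<and> \<phi> (t a) \<le> \<phi> m) \<and> (P \<noteq> [] \<longrightarrow> \<phi> n < \<phi> m)"
  using assms
proof (induction P arbitrary: n)
  case (Cons a P)
  then have IH: "distinct P" "\<forall>b\<in>set P. \<phi> (t a) \<le> \<phi> (s b) \<and> \<phi> (t b) \<le> \<phi> m" "P \<noteq> [] \<longrightarrow> \<phi> (t a) < \<phi> m"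
    and a: "s a = n" "\<phi> n < \<phi> (t a)" "P = [] \<Longrightarrow> t a = m"
    by fastforce+
  from IH a show ?case by (cases "P = []") fastforce+
qed simp

lemma positive_outflow:
  assumes "finite E" "0 < (\<Sum>a\<in>{a \<in> E. s a = n}. f a)"
  obtains a where "a \<in> E" "s a = n" "0 < (f a :: real)"
  using assms(2) by (metis (mono_tags, lifting) mem_Collect_eq not_less sum_nonpos)

lemma positive_outflow_after:
  assumes "finite E" "flow E s t src snk v f" "0 \<le> v" "a \<in> E" "0 < f a" "t a \<noteq> snk \<or> v = 0"
  obtains b where "b \<in> E" "s b = t a" "0 < f b"
proof -
  have "f a \<le> (\<Sum>b\<in>{b \<in> E. t b = t a}. f b)"
    using assms by (intro member_le_sum) (auto simp: flow_def)
  moreover have "0 \<le> excess E s t f (t a)"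
    using assms(2,3,6) by (auto simp: flow_def)
  ultimately have "0 < (\<Sum>b\<in>{b \<in> E. s b = t a}. f b)"
    using assms(5) by (simp add: excess_def)
  then show thesis using that positive_outflow[OF assms(1)] by metis
qed

lemma zero_flow:
  assumes fin: "finite E" and fl: "flow E s t src snk 0 f" and asc: "ascending E s t \<phi> f" and "a \<in> E"
  shows "f a = 0"
proof (rule ccontr)
  \<comment> \<open>The flow must continue past the positive arc whose head has the highest potential.\<close>
  assume "f a \<noteq> 0"
  define A where "A = {a \<in> E. 0 < f a}"
  have A: "finite A" "A \<noteq> {}"
    using fin fl \<open>a \<in> E\<close> \<open>f a \<noteq> 0\<close> by (auto simp: A_def flow_def less_le)
  then have "Max (\<phi> ` t ` A) \<in> \<phi> ` t ` A" by simp
  then obtain b where b: "b \<in> A" "\<phi> (t b) = Max (\<phi> ` t ` A)" by auto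
  obtain c where c: "c \<in> E" "s c = t b" "0 < f c"
    using positive_outflow_after[OF fin fl] b(1) by (auto simp: A_def)
  then have "\<phi> (t b) < \<phi> (t c)" using asc by (auto simp: ascending_def)
  moreover have "\<phi> (t c) \<le> Max (\<phi> ` t ` A)" using A c by (intro Max_ge) (auto simp: A_def)
  ultimately show False using b by simp
qed

lemma positive_walk_from:
  assumes fin: "finite E" and fl: "flow E s t src snk v f" and v: "0 \<le> v" and asc: "ascending E s t \<phi> f"
    and a: "a \<in> E" "0 < f a"
  shows "\<exists>P. walk s t (s a) P snk \<and> a \<in> set P \<and> (\<forall>b\<in>set P. b \<in> E \<and> 0 < f b)"
  using a
proof (induction "card {b \<in> E. \<phi> (s a) \<le> \<phi> (s b)}" arbitrary: a rule: less_induct)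
  case less
  show ?case
  proof (cases "t a = snk")
    case True
    then show ?thesis using less.prems by (intro exI[of _ "[a]"]) auto
  next
    case False
    then obtain b where b: "b \<in> E" "s b = t a" "0 < f b"
      using positive_outflow_after[OF fin fl v less.prems] by auto
    have up: "\<phi> (s a) < \<phi> (t a)" using asc less.prems by (auto simp: ascending_def)
    have "a \<in> {c \<in> E. \<phi> (s a) \<le> \<phi> (s c)} - {c \<in> E. \<phi> (s b) \<le> \<phi> (s c)}"
      using up b less.prems by auto
    then have "{c \<in> E. \<phi> (s b) \<le> \<phi> (s c)} \<subset> {c \<in> E. \<phi> (s a) \<le> \<phi> (s c)}"
      using up b by fastforce
    then have "card {c \<in> E. \<phi> (s b) \<le> \<phi> (s c)} < card {c \<in> E. \<phi> (s a) \<le> \<phi> (s c)}"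
      using fin by (intro psubset_card_mono) auto
    from less.hyps[OF this b(1,3)] obtain P
      where "walk s t (s b) P snk" "\<forall>b\<in>set P. b \<in> E \<and> 0 < f b" by auto
    then show ?thesis using b less.prems by (intro exI[of _ "a # P"]) auto
  qed
qed

lemma positive_walk:
  assumes "finite E" "flow E s t src snk v f" "0 < v" "ascending E s t \<phi> f"
  obtains P where "walk s t src P snk" "\<forall>a\<in>set P. a \<in> E \<and> 0 < f a" "P \<noteq> []"
proof -
  have "0 < excess E s t f src" using assms by (auto simp: flow_def)
  moreover have "0 \<le> (\<Sum>a\<in>{a \<in> E. t a = src}. f a)"
    using assms by (intro sum_nonneg) (auto simp: flow_def)
  ultimately have "0 < (\<Sum>a\<in>{a \<in> E. s a = src}. f a)" by (simp add: excess_def)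
  then obtain a where "a \<in> E" "s a = src" "0 < f a"
    using positive_outflow[OF assms(1)] by metis
  then show thesis
    using that positive_walk_from[OF assms(1,2) _ assms(4)] assms(3) by fastforce
qed

text \<open>
  Subtracting a walk of weight \<open>\<theta>\<close> lowers the value of the flow by \<open>\<theta>\<close>. Multiplicities enter as
  \<open>count_list\<close>, which obeys flow balance along any walk; here the walk repeats no arc, so they are
  \<open>0\<close> or \<open>1\<close>.
\<close>

lemma flow_minus_walk:
  assumes fin: "finite E" and fl: "flow E s t src snk v f" and asc: "ascending E s t \<phi> f"
    and P: "walk s t src P snk" "\<forall>a\<in>set P. a \<in> E \<and> 0 < f a" and "src \<noteq> snk"
    and \<theta>: "0 \<le> \<theta>" "\<forall>a\<in>set P. \<theta> \<le> f a"
    and g_def: "g = (\<lambda>a. f a - \<theta> * real (count_list P a))"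
  shows "flow E s t src snk (v - \<theta>) g" "ascending E s t \<phi> g" "\<And>a. a \<in> E \<Longrightarrow> g a \<le> f a"
    "\<And>a. a \<in> set P \<Longrightarrow> g a = f a - \<theta>"
proof -
  have "distinct P" using walk_distinct[OF P(1), of \<phi>] P(2) asc by (auto simp: ascending_def)
  then have cnt: "real (count_list P a) = of_bool (a \<in> set P)" for a
    by (simp add: count_list_distinct)
  show le: "g a \<le> f a" if "a \<in> E" for a using \<theta>(1) by (simp add: g_def)
  show "g a = f a - \<theta>" if "a \<in> set P" for a using that by (simp add: g_def cnt)
  have "excess E s t g n = excess E s t f n - \<theta> * excess E s t (\<lambda>a. real (count_list P a)) n" for n
    by (simp add: excess_def g_def sum_subtractf right_diff_distrib sum_distrib_left)
  then have "excess E s t g n = excess E s t f n - \<theta> * (of_bool (n = src) - of_bool (n = snk))" for n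
    using excess_walk[OF fin _ P(1)] P(2) by (simp add: subset_iff)
  then show "flow E s t src snk (v - \<theta>) g"
    using fl \<theta> \<open>src \<noteq> snk\<close> by (auto simp: flow_def g_def cnt)
  show "ascending E s t \<phi> g"
    using asc le unfolding ascending_def by (meson less_le_trans)
qed

lemma flow_decomposition:
  assumes fin: "finite E" and fl: "flow E s t src snk v f" and asc: "ascending E s t \<phi> f"
    and v: "0 \<le> v" and ne: "src \<noteq> snk"
  shows "\<exists>(n::nat) \<theta> P. (\<forall>k<n. 0 \<le> \<theta> k \<and> walk s t src (P k) snk \<and> set (P k) \<subseteq> E) \<and> (\<Sum>k<n. \<theta> k) = v \<and>
    (\<forall>a\<in>E. f a = (\<Sum>k<n. \<theta> k * real (count_list (P k) a)))"
  using fl asc v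
proof (induction "card {a \<in> E. 0 < f a}" arbitrary: f v rule: less_induct)
  case less
  note fl = less.prems(1) and asc = less.prems(2)
  show ?case
  proof (cases "v = 0")
    case True
    then have "flow E s t src snk 0 f" using fl by simp
    then have "\<forall>a\<in>E. f a = 0" by (intro ballI zero_flow[OF fin _ asc])
    with True show ?thesis by (intro exI[of _ 0]) simp
  next
    case False
    then have "0 < v" using less.prems(3) by simp
    from positive_walk[OF fin fl this asc] obtain P
      where P: "walk s t src P snk" "\<forall>a\<in>set P. a \<in> E \<and> 0 < f a" "P \<noteq> []" .
    \<comment> \<open>Including the value of the flow in the minimum keeps the remaining value nonnegative. Either
       that value drops to zero, or an arc leaves the support.\<close>
    define \<theta> where "\<theta> = Min (insert v (f ` set P))"
    have "\<theta> \<in> insert v (f ` set P)" unfolding \<theta>_def by (intro Min_in) auto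
    moreover have "\<forall>u\<in>insert v (f ` set P). \<theta> \<le> u" unfolding \<theta>_def by (intro ballI Min_le) auto
    ultimately have \<theta>: "0 \<le> \<theta>" "\<forall>a\<in>set P. \<theta> \<le> f a" "\<theta> \<le> v" "\<theta> = v \<or> (\<exists>a\<in>set P. \<theta> = f a)"
      using less.prems(3) P(2) by (fastforce intro: less_imp_le)+
    define g where "g = (\<lambda>a. f a - \<theta> * real (count_list P a))"
    note g = flow_minus_walk[OF fin fl asc P(1,2) ne \<theta>(1,2) g_def]
    have "\<exists>(n::nat) \<eta> Q. (\<forall>k<n. 0 \<le> \<eta> k \<and> walk s t src (Q k) snk \<and> set (Q k) \<subseteq> E) \<and> (\<Sum>k<n. \<eta> k) = v - \<theta> \<and>
      (\<forall>a\<in>E. g a = (\<Sum>k<n. \<eta> k * real (count_list (Q k) a)))"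
    proof (cases "\<theta> = v")
      case True
      then have "flow E s t src snk 0 g" using g(1) by simp
      then have "\<forall>a\<in>E. g a = 0" by (intro ballI zero_flow[OF fin _ g(2)])
      with True show ?thesis by (intro exI[of _ 0]) simp
    next
      case False
      then obtain a where a: "a \<in> set P" "\<theta> = f a" using \<theta>(4) by auto
      have "0 < f b" if "b \<in> E" "0 < g b" for b using g(3)[OF that(1)] that(2) by linarith
      then have "{a \<in> E. 0 < g a} \<subseteq> {a \<in> E. 0 < f a}" by blast
      moreover have "a \<in> {a \<in> E. 0 < f a} - {a \<in> E. 0 < g a}"
        using g(4)[OF a(1)] a P(2) by simp
      ultimately have "{a \<in> E. 0 < g a} \<subset> {a \<in> E. 0 < f a}" by blast
      then have "card {a \<in> E. 0 < g a} < card {a \<in> E. 0 < f a}"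
        using fin by (intro psubset_card_mono) auto
      moreover have "0 \<le> v - \<theta>" using \<theta>(3) by simp
      ultimately show ?thesis by (rule less.hyps[OF _ g(1,2)])
    qed
    then obtain n :: nat and \<eta> Q where Q: "\<forall>k<n. 0 \<le> \<eta> k \<and> walk s t src (Q k) snk \<and> set (Q k) \<subseteq> E"
      "(\<Sum>k<n. \<eta> k) = v - \<theta>" "\<forall>a\<in>E. g a = (\<Sum>k<n. \<eta> k * real (count_list (Q k) a))" by blast
    show ?thesis
    proof (intro exI conjI)
      let ?\<eta> = "\<lambda>k. if k < n then \<eta> k else \<theta>" and ?Q = "\<lambda>k. if k < n then Q k else P"
      show "\<forall>k<Suc n. 0 \<le> ?\<eta> k \<and> walk s t src (?Q k) snk \<and> set (?Q k) \<subseteq> E"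
        using Q(1) P(1,2) \<theta>(1) by auto
      show "(\<Sum>k<Suc n. ?\<eta> k) = v" using Q(2) by simp
      show "\<forall>a\<in>E. f a = (\<Sum>k<Suc n. ?\<eta> k * real (count_list (?Q k) a))"
      proof
        fix a assume "a \<in> E"
        then have "f a = g a + \<theta> * real (count_list P a)" by (simp add: g_def)
        also have "g a = (\<Sum>k<n. \<eta> k * real (count_list (Q k) a))" using Q(3) \<open>a \<in> E\<close> by blast
        finally show "f a = (\<Sum>k<Suc n. ?\<eta> k * real (count_list (?Q k) a))" by simp
      qed
    qed
  qed
qed

lemma binary_flow:
  assumes fin: "finite E" and fl: "flow E s t src snk 1 f" and asc: "ascending E s t \<phi> f"
    and ne: "src \<noteq> snk" and bin: "\<forall>a\<in>E. f a \<in> {0, 1}"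
  obtains P where "walk s t src P snk" "set P \<subseteq> E" "distinct P"
    "\<forall>a\<in>E. f a = real (count_list P a)"
proof -
  obtain P where P: "walk s t src P snk" "\<forall>a\<in>set P. a \<in> E \<and> 0 < f a" "P \<noteq> []"
    using positive_walk[OF fin fl _ asc] by auto
  have "\<forall>a\<in>set P. 1 \<le> f a" using P(2) bin by fastforce
  note g = flow_minus_walk[OF fin fl asc P(1,2) ne _ this refl]
  have "flow E s t src snk 0 (\<lambda>a. f a - 1 * real (count_list P a))" using g(1) by simp
  from zero_flow[OF fin this g(2)] have "\<forall>a\<in>E. f a = real (count_list P a)"
    by fastforce
  moreover have "distinct P" using walk_distinct[OF P(1), of \<phi>] P(2) asc by (auto simp: ascending_def)
  ultimately show thesis using that P by blast
qed

section \<open>Trips as walks in the load-expanded network\<close>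

lemma successively_nth:
  "successively R P \<longleftrightarrow> (\<forall>h. Suc h < length P \<longrightarrow> R (P ! h) (P ! Suc h))"
proof (induction P)
  case (Cons a P)
  then show ?case by (cases P) (auto simp: successively_Cons less_Suc_eq_0_disj)
qed simp

lemma walk_iff:
  "walk s t n P m \<longleftrightarrow> (if P = [] then n = m else s (hd P) = n \<and> t (last P) = m \<and>
     successively (\<lambda>a b. t a = s b) P)"
  by (induction P arbitrary: n) (auto simp: successively_Cons)

lemma checkpoint_nth_less:
  assumes "valid_data D" "a < b" "b < length (checkpoints D)"
  shows "sched D (checkpoints D ! a) < sched D (checkpoints D ! b)"
  using assms sorted_wrt_nth_less[of _ "checkpoints D"] by (auto simp: valid_data_def)

lemma checkpoints_nonempty: "valid_data D \<Longrightarrow> checkpoints D \<noteq> []"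
  by (auto simp: valid_data_def)

lemma origin_conv_nth: "valid_data D \<Longrightarrow> origin D = checkpoints D ! 0"
  by (simp add: origin_def hd_conv_nth checkpoints_nonempty)

lemma destination_conv_nth: "valid_data D \<Longrightarrow> destination D = checkpoints D ! (length (checkpoints D) - 1)"
  by (simp add: destination_def last_conv_nth checkpoints_nonempty)

lemma sched_bounds:
  assumes "valid_data D" "k \<in> set (checkpoints D)"
  shows "sched D (origin D) \<le> sched D k" "sched D k \<le> sched D (destination D)"
proof -
  obtain a where a: "k = checkpoints D ! a" "a < length (checkpoints D)"
    using assms(2) by (metis in_set_conv_nth)
  show "sched D (origin D) \<le> sched D k"
    using a checkpoint_nth_less[OF assms(1), of 0 a] origin_conv_nth[OF assms(1)] by (cases a) auto
  show "sched D k \<le> sched D (destination D)"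
    using a checkpoint_nth_less[OF assms(1), of a "length (checkpoints D) - 1"]
      destination_conv_nth[OF assms(1)]
    by (cases "a = length (checkpoints D) - 1") (auto simp: less_le)
qed

lemma origin_less_destination:
  assumes "valid_data D"
  shows "sched D (origin D) < sched D (destination D)"
proof -
  have "2 \<le> length (checkpoints D)" using assms by (simp add: valid_data_def)
  then show ?thesis
    using checkpoint_nth_less[OF assms, of 0 "length (checkpoints D) - 1"]
    by (simp add: origin_conv_nth[OF assms] destination_conv_nth[OF assms])
qed

lemma origin_neq_destination: "valid_data D \<Longrightarrow> origin D \<noteq> destination D"
  using origin_less_destination by fastforce

lemma endpoints_in_checkpoints:
  assumes "valid_data D"
  shows "origin D \<in> set (checkpoints D)" "destination D \<in> set (checkpoints D)"
  using checkpoints_nonempty[OF assms] by (simp_all add: origin_def destination_def)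

lemma subpath_ends:
  assumes "valid_data D" "r \<in> subpaths D"
  shows "sp_start r \<in> set (checkpoints D)" "sp_end r \<in> set (checkpoints D)"
    "sched D (sp_start r) < sched D (sp_end r)"
proof -
  obtain a b where "a < b" "b < length (checkpoints D)"
    "sp_start r = checkpoints D ! a" "sp_end r = checkpoints D ! b"
    using assms(2) by (auto simp: subpaths_def)
  then show "sp_start r \<in> set (checkpoints D)" "sp_end r \<in> set (checkpoints D)"
    "sched D (sp_start r) < sched D (sp_end r)"
    using checkpoint_nth_less[OF assms(1)] by auto
qed

text \<open>
  A nonempty list is forced by the walk, because the origin differs from the destination.
\<close>

lemma is_trip_iff:
  assumes "valid_data D"
  shows "is_trip D rs \<longleftrightarrow> set rs \<subseteq> subpaths D \<and>
    walk sp_start sp_end (origin D) rs (destination D) \<and> (\<Sum>r\<leftarrow>rs. load D r) \<le> capacity D"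
  using origin_neq_destination[OF assms] by (auto simp: is_trip_def walk_iff successively_nth)

text \<open>
  The arcs of the load-expanded network that a vehicle uses when it follows the subpaths \<open>rs\<close>, starting with load
  \<open>c\<close>; the last one is the terminating arc.
\<close>

fun trip_arcs :: "('l, 'p) trip_data \<Rightarrow> nat \<Rightarrow> ('l, 'p) subpath list \<Rightarrow> ('l, 'p) arc list" where
  "trip_arcs D c [] = [Terminate c]"
| "trip_arcs D c (r # rs) = Travel r c (c + load D r) # trip_arcs D (c + load D r) rs"

lemma trip_arcs_walk:
  assumes "set rs \<subseteq> subpaths D" "walk sp_start sp_end k rs (destination D)"
    "c + (\<Sum>r\<leftarrow>rs. load D r) \<le> capacity D"
  shows "walk (arc_tail D) (arc_head D) (At k c) (trip_arcs D c rs) Sink \<and>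
    set (trip_arcs D c rs) \<subseteq> arcs D"
  using assms by (induction rs arbitrary: k c) (auto simp: arcs_def)

lemma walk_is_trip_arcs:
  assumes "walk (arc_tail D) (arc_head D) (At k c) P Sink" "set P \<subseteq> arcs D"
  shows "\<exists>rs. P = trip_arcs D c rs \<and> set rs \<subseteq> subpaths D \<and>
    walk sp_start sp_end k rs (destination D) \<and> (c \<le> capacity D \<longrightarrow> c + (\<Sum>r\<leftarrow>rs. load D r) \<le> capacity D)"
  using assms
proof (induction P arbitrary: k c)
  case (Cons a P)
  have "(\<exists>r c1 c2. a = Travel r c1 c2) \<or> (\<exists>c1. a = Terminate c1)" by (cases a) auto
  then show ?case
  proof (elim disjE exE)
    fix r c1 c2 assume a: "a = Travel r c1 c2"
    then have r: "r \<in> subpaths D" "c1 = c" "sp_start r = k" "c2 = c + load D r" "c2 \<le> capacity D"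
      and w: "walk (arc_tail D) (arc_head D) (At (sp_end r) c2) P Sink"
      using Cons.prems by (auto simp: arcs_def)
    obtain rs where "P = trip_arcs D c2 rs" "set rs \<subseteq> subpaths D"
      "walk sp_start sp_end (sp_end r) rs (destination D)" "c2 + (\<Sum>r\<leftarrow>rs. load D r) \<le> capacity D"
      using Cons.IH[OF w] Cons.prems(2) r(5) by auto
    then show ?thesis using a r by (intro exI[of _ "r # rs"]) auto
  next
    fix c1 assume a: "a = Terminate c1"
    then have "walk (arc_tail D) (arc_head D) Sink P Sink" using Cons.prems by simp
    moreover have "arc_tail D b \<noteq> Sink" for b by (cases b) auto
    ultimately have "P = []" by (cases P) auto
    then show ?thesis using a Cons.prems by (intro exI[of _ "[]"]) auto
  qed
qed simp

text \<open>
  A potential for the load-expanded network: scheduled times, with the sink placed after the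
  destination.
\<close>

fun node_time :: "('l, 'p) trip_data \<Rightarrow> 'l node \<Rightarrow> real" where
  "node_time D (At k c) = sched D k"
| "node_time D Sink = sched D (destination D) + 1"

lemma arc_ascends:
  assumes "valid_data D" "a \<in> arcs D"
  shows "node_time D (arc_tail D a) < node_time D (arc_head D a)"
  using assms by (cases a) (auto simp: arcs_def subpath_ends)

text \<open>
  The balance constraints are stated for the nodes of the network only; they extend to all elements
  of the node type because every arc starts and ends at a node of the network.
\<close>

lemma network_flow_iff:
  assumes "valid_data D"
  shows "network_constraints D x z y \<and> (\<forall>a\<in>arcs D. 0 \<le> y a) \<longleftrightarrow>
    flow (arcs D) (arc_tail D) (arc_head D) (source D) Sink x y \<and>
    (\<forall>p\<in>requests D. compatible D p \<longrightarrow> (\<Sum>a\<in>{a \<in> arcs D. p \<in> arc_served a}. y a) \<le> z p)"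
proof -
  have "arc_tail D a \<in> nodes D" "arc_head D a \<in> nodes D" if "a \<in> arcs D" for a
    using that subpath_ends[OF assms] endpoints_in_checkpoints[OF assms]
    by (cases a; auto simp: arcs_def nodes_def)+
  then have none: "{a \<in> arcs D. arc_tail D a = n} = {} \<and> {a \<in> arcs D. arc_head D a = n} = {}"
    if "n \<notin> nodes D" for n using that by blast
  have "excess (arcs D) (arc_tail D) (arc_head D) y n = 0" if "n \<notin> nodes D" for n
  proof -
    have "{a \<in> arcs D. arc_tail D a = n} = {}" "{a \<in> arcs D. arc_head D a = n} = {}"
      using none[OF that] by auto
    then show ?thesis unfolding excess_def by (simp only: sum.empty)
  qed
  moreover have "source D \<in> nodes D" "Sink \<in> nodes D"
    using endpoints_in_checkpoints[OF assms] by (auto simp: source_def nodes_def)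
  ultimately have all: "(\<forall>n\<in>nodes D. excess (arcs D) (arc_tail D) (arc_head D) y n =
        (if n = source D then x else if n = Sink then - x else 0)) \<longleftrightarrow>
      (\<forall>n. excess (arcs D) (arc_tail D) (arc_head D) y n =
        (if n = source D then x else if n = Sink then - x else 0))"
    unfolding Ball_def by (intro all_cong1) auto
  then show ?thesis
    unfolding network_constraints_def flow_def excess_def by blast
qed

text \<open>
  How many subpaths of the trip serve \<open>p\<close>. Nothing in the definition of a trip forbids more than
  one; only the assignment constraint does, and only for the network solution as a whole.
\<close>

definition times_served :: "'p \<Rightarrow> ('l, 'p) subpath list \<Rightarrow> nat" where
  "times_served p rs = length (filter (\<lambda>r. p \<in> served r) rs)"

lemma trip_arcs_served: "length (filter (\<lambda>a. p \<in> arc_served a) (trip_arcs D c rs)) = times_served p rs"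
  by (induction rs arbitrary: c) (auto simp: times_served_def)

lemma trip_arcs_cost: "(\<Sum>a\<leftarrow>trip_arcs D c rs. arc_cost D a) = (\<Sum>r\<leftarrow>rs. subpath_cost D r)"
  by (induction rs arbitrary: c) auto

lemma trip_arcs_cost_sum:
  assumes "valid_data D" "set (trip_arcs D c rs) \<subseteq> arcs D"
  shows "(\<Sum>a\<in>arcs D. arc_cost D a * real (count_list (trip_arcs D c rs) a)) = (\<Sum>r\<leftarrow>rs. subpath_cost D r)"
  using sum_count_list[OF finite_arcs[OF assms(1)] assms(2), where g = "arc_cost D" and Q = "\<lambda>_. True"]
  by (simp add: trip_arcs_cost)

lemma trip_arcs_served_sum:
  assumes "valid_data D" "set (trip_arcs D c rs) \<subseteq> arcs D"
  shows "(\<Sum>a\<in>{a \<in> arcs D. p \<in> arc_served a}. real (count_list (trip_arcs D c rs) a)) = real (times_served p rs)"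
  using sum_count_list_length[OF finite_arcs[OF assms(1)] assms(2), where Q = "\<lambda>a. p \<in> arc_served a"]
  by (simp add: trip_arcs_served)

lemma source_walk_is_trip:
  assumes "valid_data D" "walk (arc_tail D) (arc_head D) (source D) P Sink" "set P \<subseteq> arcs D"
  shows "\<exists>rs. P = trip_arcs D 0 rs \<and> is_trip D rs"
  using walk_is_trip_arcs[OF assms(2)[unfolded source_def] assms(3)] by (auto simp: is_trip_iff[OF assms(1)])

lemma ascending_network: "valid_data D \<Longrightarrow> ascending (arcs D) (arc_tail D) (arc_head D) (node_time D) y"
  using arc_ascends by (auto simp: ascending_def)

lemma network_decomposition:
  assumes V: "valid_data D" and y: "network_constraints D x z y" "\<forall>a\<in>arcs D. 0 \<le> y a" and x: "0 \<le> x"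
  shows "\<exists>(n::nat) \<theta> rs. (\<forall>k<n. 0 \<le> \<theta> k \<and> is_trip D (rs k)) \<and> (\<Sum>k<n. \<theta> k) = x \<and>
    network_cost D y = (\<Sum>k<n. \<theta> k * (\<Sum>r\<leftarrow>rs k. subpath_cost D r)) \<and>
    (\<forall>p\<in>requests D. compatible D p \<longrightarrow> (\<Sum>k<n. \<theta> k * real (times_served p (rs k))) \<le> z p)"
proof -
  note fin = finite_arcs[OF V]
  have fl: "flow (arcs D) (arc_tail D) (arc_head D) (source D) Sink x y"
    using y network_flow_iff[OF V] by blast
  have "source D \<noteq> Sink" by (simp add: source_def)
  from flow_decomposition[OF fin fl ascending_network[OF V] x this] obtain n :: nat and \<theta> P
    where P: "\<And>k. k < n \<Longrightarrow> 0 \<le> \<theta> k \<and> walk (arc_tail D) (arc_head D) (source D) (P k) Sink \<and> set (P k) \<subseteq> arcs D"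
      "(\<Sum>k<n. \<theta> k) = x" "\<And>a. a \<in> arcs D \<Longrightarrow> y a = (\<Sum>k<n. \<theta> k * real (count_list (P k) a))" by blast
  have "\<forall>k. \<exists>rs. k < n \<longrightarrow> P k = trip_arcs D 0 rs \<and> is_trip D rs"
    using source_walk_is_trip[OF V] P(1) by blast
  then obtain rs where rs: "\<And>k. k < n \<Longrightarrow> P k = trip_arcs D 0 (rs k) \<and> is_trip D (rs k)" by metis
  have sub: "set (trip_arcs D 0 (rs k)) \<subseteq> arcs D" if "k < n" for k using P(1) rs that by metis
  have "network_cost D y = (\<Sum>a\<in>arcs D. \<Sum>k<n. \<theta> k * (arc_cost D a * real (count_list (P k) a)))"
    unfolding network_cost_def by (intro sum.cong) (auto simp: P(3) sum_distrib_left mult_ac)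
  also have "\<dots> = (\<Sum>k<n. \<theta> k * (\<Sum>a\<in>arcs D. arc_cost D a * real (count_list (P k) a)))"
    by (subst sum.swap) (simp add: sum_distrib_left)
  also have "\<dots> = (\<Sum>k<n. \<theta> k * (\<Sum>r\<leftarrow>rs k. subpath_cost D r))"
    using rs trip_arcs_cost_sum[OF V sub] by (intro sum.cong) auto
  finally have cost: "network_cost D y = \<dots>" .
  have "(\<Sum>k<n. \<theta> k * real (times_served p (rs k))) = (\<Sum>a\<in>{a \<in> arcs D. p \<in> arc_served a}. y a)" for p
  proof -
    have "(\<Sum>a\<in>{a \<in> arcs D. p \<in> arc_served a}. y a)
        = (\<Sum>a\<in>{a \<in> arcs D. p \<in> arc_served a}. \<Sum>k<n. \<theta> k * real (count_list (P k) a))"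
      by (intro sum.cong) (auto simp: P(3))
    also have "\<dots> = (\<Sum>k<n. \<theta> k * (\<Sum>a\<in>{a \<in> arcs D. p \<in> arc_served a}. real (count_list (P k) a)))"
      by (subst sum.swap) (simp add: sum_distrib_left)
    also have "\<dots> = (\<Sum>k<n. \<theta> k * real (times_served p (rs k)))"
      using rs trip_arcs_served_sum[OF V sub] by (intro sum.cong) auto
    finally show ?thesis by simp
  qed
  then show ?thesis
    using P(1,2) rs cost y(1) unfolding network_constraints_def
    by (intro exI[of _ n] exI[of _ \<theta>] exI[of _ rs]) simp
qed

lemma binary_network_trip:
  assumes V: "valid_data D" and y: "network_feasible D 1 z y"
  obtains rs where "is_trip D rs" "network_cost D y = (\<Sum>r\<leftarrow>rs. subpath_cost D r)"
    "\<And>p. p \<in> requests D \<Longrightarrow> compatible D p \<Longrightarrow> real (times_served p rs) \<le> z p"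
proof -
  note fin = finite_arcs[OF V]
  have nn: "\<forall>a\<in>arcs D. 0 \<le> y a" and bin: "\<forall>a\<in>arcs D. y a \<in> {0, 1}"
    using y by (auto simp: network_feasible_def)
  have fl: "flow (arcs D) (arc_tail D) (arc_head D) (source D) Sink 1 y"
    using y nn network_flow_iff[OF V] unfolding network_feasible_def by blast
  have "source D \<noteq> Sink" by (simp add: source_def)
  from binary_flow[OF fin fl ascending_network[OF V] this bin] obtain P
    where P: "walk (arc_tail D) (arc_head D) (source D) P Sink" "set P \<subseteq> arcs D"
      and "distinct P" and yP: "\<forall>a\<in>arcs D. y a = real (count_list P a)" .
  from source_walk_is_trip[OF V P(1,2)] obtain rs where rs: "P = trip_arcs D 0 rs" "is_trip D rs" by blast
  note sub = P(2)[unfolded rs(1)]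
  have cost: "network_cost D y = (\<Sum>r\<leftarrow>rs. subpath_cost D r)"
    using trip_arcs_cost_sum[OF V sub] yP rs(1) by (simp add: network_cost_def)
  have sv: "(\<Sum>a\<in>{a \<in> arcs D. p \<in> arc_served a}. y a) = real (times_served p rs)" for p
    using trip_arcs_served_sum[OF V sub, of p] yP rs(1) by simp
  have "real (times_served p rs) \<le> z p" if "p \<in> requests D" "compatible D p" for p
  proof -
    have "(\<Sum>a\<in>{a \<in> arcs D. p \<in> arc_served a}. y a) \<le> z p"
      using y that unfolding network_feasible_def network_constraints_def by blast
    then show ?thesis by (simp only: sv)
  qed
  with that rs(2) cost show thesis by blast
qed

lemma trip_network_feasible:
  assumes V: "valid_data D" and rs: "is_trip D rs"
    and served: "\<And>p. p \<in> requests D \<Longrightarrow> real (times_served p rs) \<le> z p"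
  shows "\<exists>y. network_feasible D 1 z y \<and> network_cost D y = (\<Sum>r\<leftarrow>rs. subpath_cost D r)"
proof -
  define P where "P = trip_arcs D 0 rs"
  have P: "walk (arc_tail D) (arc_head D) (source D) P Sink" "set P \<subseteq> arcs D"
    using rs trip_arcs_walk[of rs D "origin D" 0] by (auto simp: is_trip_iff[OF V] P_def source_def)
  have "distinct P"
    using walk_distinct[OF P(1), of "node_time D"] arc_ascends[OF V] P(2) by blast
  then have "real (count_list P a) \<in> {0, 1}" for a by (simp add: count_list_distinct)
  moreover have "source D \<noteq> Sink" by (simp add: source_def)
  then have "flow (arcs D) (arc_tail D) (arc_head D) (source D) Sink 1 (\<lambda>a. real (count_list P a))"
    by (auto simp: flow_def excess_walk[OF finite_arcs[OF V] P(2,1)])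
  then have "network_constraints D 1 z (\<lambda>a. real (count_list P a))"
    using network_flow_iff[OF V, of 1 z "\<lambda>a. real (count_list P a)"] served
      trip_arcs_served_sum[OF V P(2)[unfolded P_def]] by (simp add: P_def)
  ultimately show ?thesis
    using trip_arcs_cost_sum[OF V P(2)[unfolded P_def]]
    by (intro exI[of _ "\<lambda>a. real (count_list P a)"])
      (simp add: network_feasible_def network_cost_def P_def)
qed

section \<open>The timed run of a trip\<close>

text \<open>
  The pairs of consecutive elements of a list.
\<close>

definition adj :: "'a list \<Rightarrow> ('a \<times> 'a) list" where
  "adj ks = zip ks (tl ks)"

lemma adj_simps [simp]: "adj [] = []" "adj [a] = []" "adj (a # b # ks) = (a, b) # adj (b # ks)"
  by (simp_all add: adj_def)

lemma adj_append: "A \<noteq> [] \<Longrightarrow> B \<noteq> [] \<Longrightarrow> last A = hd B \<Longrightarrow> adj (A @ tl B) = adj A @ adj B"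
proof (induction A rule: induct_list012)
  case (2 a)
  then show ?case by (cases B) auto
qed auto

lemma adj_map: "adj (map f ks) = map (map_prod f f) (adj ks)"
  by (simp add: adj_def map_tl[symmetric] zip_map_map map_prod_def)

lemma successively_adj: "successively R ks \<longleftrightarrow> (\<forall>(a, b)\<in>set (adj ks). R a b)"
  by (induction R ks rule: successively.induct) auto

lemma walk_adj: "ks \<noteq> [] \<Longrightarrow> walk fst snd (hd ks) (adj ks) (last ks)"
  by (induction ks rule: induct_list012) auto

lemma adj_distinct: "distinct ks \<Longrightarrow> distinct (adj ks)"
  by (simp add: adj_def distinct_zipI1)

lemma mem_adj:
  assumes "2 \<le> length ks" "i \<in> set ks"
  shows "\<exists>a\<in>set (adj ks). fst a = i \<or> snd a = i"
proof -
  obtain h where h: "h < length ks" "ks ! h = i" using assms(2) by (auto simp: in_set_conv_nth)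
  have nth: "(ks ! m, ks ! Suc m) \<in> set (adj ks)" if "Suc m < length ks" for m
    using that unfolding adj_def by (auto simp: set_zip nth_tl intro!: exI[of _ m])
  show ?thesis
  proof (cases "Suc h < length ks")
    case True
    then show ?thesis using nth[OF True] h by force
  next
    case False
    then have "Suc (h - 1) < length ks" "Suc (h - 1) = h" using assms(1) h by auto
    then show ?thesis using nth[of "h - 1"] h by force
  qed
qed

text \<open>
  The number of pairs that leave or enter \<open>i\<close>; a pair \<open>(i, i)\<close> would count twice.
\<close>

definition degree :: "'a \<Rightarrow> ('a \<times> 'a) list \<Rightarrow> nat" where
  "degree i P = length (filter (\<lambda>a. fst a = i) P) + length (filter (\<lambda>a. snd a = i) P)"

lemma degree_append [simp]: "degree i (P @ Q) = degree i P + degree i Q"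
  by (simp add: degree_def)

lemma degree_pos_iff: "1 \<le> degree i P \<longleftrightarrow> (\<exists>a\<in>set P. fst a = i \<or> snd a = i)"
  by (induction P) (auto simp: degree_def)

lemma degree_adj:
  assumes "2 \<le> length ks"
  shows "i \<in> set ks \<Longrightarrow> 1 \<le> degree i (adj ks)" "i \<notin> set ks \<Longrightarrow> degree i (adj ks) = 0"
proof -
  show "1 \<le> degree i (adj ks)" if "i \<in> set ks" using mem_adj[OF assms that] by (simp only: degree_pos_iff)
  have "fst a \<in> set ks \<and> snd a \<in> set ks" if "a \<in> set (adj ks)" for a
  proof -
    have "(fst a, snd a) \<in> set (zip ks (tl ks))" using that by (simp add: adj_def)
    from set_zip_leftD[OF this] set_zip_rightD[OF this] show ?thesis by (cases ks) auto
  qed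
  then show "degree i (adj ks) = 0" if "i \<notin> set ks"
    using that degree_pos_iff[of i "adj ks"] by force
qed

text \<open>
  A list of stops with times that a vehicle can drive: every leg is permitted and takes at least its
  travel time, idle time is possible only before checkpoints, and checkpoints are served on
  schedule.
\<close>

definition drives :: "('l, 'p) trip_data \<Rightarrow> ('l \<times> real) list \<Rightarrow> bool" where
  "drives D L \<longleftrightarrow>
     successively (\<lambda>(i, s) (j, t). j \<in> next_locs D i \<and> s + tt D i j \<le> t \<and>
       (j \<notin> set (checkpoints D) \<longrightarrow> t = s + tt D i j)) L \<and>
     (\<forall>(i, t)\<in>set L. i \<in> stations D \<and> (i \<in> set (checkpoints D) \<longrightarrow> t = sched D i))"

lemma drives_append:
  assumes "drives D A" "drives D B" "A \<noteq> []" "B \<noteq> []" "last A = hd B"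
  shows "drives D (A @ tl B)"
  using assms by (cases B) (auto simp: drives_def successively_append_iff successively_Cons)

lemma drives_sorted:
  assumes "valid_data D" "drives D L"
  shows "sorted_wrt (\<lambda>a b. snd a < snd b) L"
proof -
  have "successively (\<lambda>a b. snd a < snd b) L"
  proof (rule successively_mono)
    show "successively (\<lambda>(i, s) (j, t). j \<in> next_locs D i \<and> s + tt D i j \<le> t \<and>
       (j \<notin> set (checkpoints D) \<longrightarrow> t = s + tt D i j)) L" using assms(2) by (simp add: drives_def)
  qed (use assms(1) in \<open>fastforce simp: next_locs_def valid_data_def\<close>)
  then show ?thesis
    by (subst (asm) successively_conv_sorted_wrt) (auto simp: transp_def)
qed

lemma drives_bounds:
  assumes "valid_data D" "drives D L" "a \<in> set L"
  shows "snd (hd L) \<le> snd a" "snd a \<le> snd (last L)"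
proof -
  obtain A B where L: "L = A @ a # B" using assms(3) by (meson split_list)
  have s: "sorted_wrt (\<lambda>a b. snd a < snd b) (A @ a # B)" using drives_sorted[OF assms(1,2)] L by simp
  show "snd (hd L) \<le> snd a" using s L by (cases A) (auto simp: sorted_wrt_append)
  show "snd a \<le> snd (last L)" using s L last_in_set[of B] by (auto simp: sorted_wrt_append less_imp_le)
qed

lemma subpath_route:
  assumes "r \<in> subpaths D"
  shows "2 \<le> length (route r)" "hd (route r) = (sp_start r, sched D (sp_start r))"
    "last (route r) = (sp_end r, sched D (sp_end r))" "route r \<noteq> []"
proof -
  show 2: "2 \<le> length (route r)" using assms by (simp add: subpaths_def)
  then show "route r \<noteq> []" by auto
  then show "hd (route r) = (sp_start r, sched D (sp_start r))"
    "last (route r) = (sp_end r, sched D (sp_end r))"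
    using assms by (auto simp: subpaths_def sp_start_def sp_end_def sp_locs_def hd_map last_map prod_eq_iff)
qed

text \<open>
  The only leg of a subpath that may contain idle time is the last one; there the bound on the total
  travel time says that the vehicle reaches the ending checkpoint in time.
\<close>

lemma subpath_drives:
  assumes V: "valid_data D" and r: "r \<in> subpaths D"
  shows "drives D (route r)"
proof -
  let ?n = "length (route r)" and ?ks = "sp_locs r" and ?C = "set (checkpoints D)"
  note R = subpath_route[OF r]
  note ne = R(4)
  have loc: "?ks ! h = fst (route r ! h)" if "h < ?n" for h using that by (simp add: sp_locs_def)
  have inner: "?ks ! h \<notin> ?C" if "0 < h" "Suc h < ?n" for h using r that by (auto simp: subpaths_def)
  have step: "snd (route r ! Suc h) = snd (route r ! h) + tt D (?ks ! h) (?ks ! Suc h)"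
    if "Suc (Suc h) < ?n" for h using r that by (auto simp: subpaths_def)
  have nxt: "?ks ! Suc h \<in> next_locs D (?ks ! h)" if "Suc h < ?n" for h
    using r that by (auto simp: subpaths_def)
  have time: "snd (route r ! h) = sched D (sp_start r) + (\<Sum>m<h. tt D (?ks ! m) (?ks ! Suc m))"
    if "Suc h < ?n" for h using that
  proof (induction h)
    case 0
    then show ?case using R(2) ne by (simp add: hd_conv_nth)
  qed (use step in simp)
  have total: "(\<Sum>m<length ?ks - 1. tt D (?ks ! m) (?ks ! Suc m)) \<le> sched D (sp_end r) - sched D (sp_start r)"
    using r by (simp add: subpaths_def travel_time_def)
  have lastleg: "snd (route r ! h) + tt D (?ks ! h) (?ks ! Suc h) \<le> sched D (sp_end r)"
    if "Suc (Suc h) = ?n" for h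
  proof -
    have h: "Suc h < ?n" and "length ?ks - 1 = Suc h" using that by (auto simp: sp_locs_def)
    then show ?thesis using total time[OF h] by simp
  qed
  have last: "route r ! (?n - 1) = (sp_end r, sched D (sp_end r))" using R(3) ne by (simp add: last_conv_nth)
  have "?ks ! Suc h \<in> next_locs D (?ks ! h) \<and>
      snd (route r ! h) + tt D (?ks ! h) (?ks ! Suc h) \<le> snd (route r ! Suc h) \<and>
      (?ks ! Suc h \<notin> ?C \<longrightarrow> snd (route r ! Suc h) = snd (route r ! h) + tt D (?ks ! h) (?ks ! Suc h))"
    if h: "Suc h < ?n" for h
  proof (cases "Suc (Suc h) < ?n")
    case True
    then show ?thesis using step nxt h by auto
  next
    case False
    then have n: "Suc (Suc h) = ?n" using h by simp
    then have "?n - 1 = Suc h" by simp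
    then have "route r ! Suc h = (sp_end r, sched D (sp_end r))" using last by simp
    then show ?thesis
      using lastleg[OF n] nxt[OF h] loc[OF h] subpath_ends[OF V r] by simp
  qed
  then have succ: "successively (\<lambda>(i, s) (j, t). j \<in> next_locs D i \<and> s + tt D i j \<le> t \<and>
       (j \<notin> ?C \<longrightarrow> t = s + tt D i j)) (route r)"
    unfolding successively_nth using loc by (simp add: case_prod_beta)
  have "fst a \<in> stations D \<and> (fst a \<in> ?C \<longrightarrow> snd a = sched D (fst a))" if a: "a \<in> set (route r)" for a
  proof -
    obtain h where h: "h < ?n" "route r ! h = a" using a by (metis in_set_conv_nth)
    have "fst a \<in> set ?ks" using a by (auto simp: sp_locs_def)
    moreover have "\<forall>k\<in>set ?ks. k \<in> stations D" using r by (simp add: subpaths_def)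
    ultimately have "fst a \<in> stations D" by blast
    moreover have "snd a = sched D (fst a)" if "fst a \<in> ?C"
    proof -
      have "\<not> (0 < h \<and> Suc h < ?n)" using inner[of h] loc[of h] h that by auto
      then have "h = 0 \<or> h = ?n - 1" using h(1) by linarith
      then show ?thesis using h R(2) last ne by (auto simp: hd_conv_nth)
    qed
    ultimately show ?thesis by blast
  qed
  then show ?thesis using succ by (auto simp: drives_def)
qed

text \<open>
  The stops and times of a chain of subpaths that starts at the checkpoint \<open>k\<close>. As in \<open>trip_stops\<close>,
  the checkpoint shared by consecutive subpaths is listed once.
\<close>

definition run_from :: "('l, 'p) trip_data \<Rightarrow> 'l \<Rightarrow> ('l, 'p) subpath list \<Rightarrow> ('l \<times> real) list" where
  "run_from D k rs = (k, sched D k) # concat (map (\<lambda>r. tl (route r)) rs)"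

lemma run_from_Nil [simp]: "run_from D k [] = [(k, sched D k)]"
  by (simp add: run_from_def)

lemma run_from_nonempty [simp]: "run_from D k rs \<noteq> []" "hd (run_from D k rs) = (k, sched D k)"
  by (simp_all add: run_from_def)

lemma run_from_Cons:
  assumes "r \<in> subpaths D" "sp_start r = k"
  shows "run_from D k (r # rs) = route r @ tl (run_from D (sp_end r) rs)"
    "last (route r) = hd (run_from D (sp_end r) rs)"
proof -
  note R = subpath_route[OF assms(1)]
  have "(k, sched D k) # tl (route r) = route r" using R(2,4) assms(2) by (metis list.collapse)
  then show "run_from D k (r # rs) = route r @ tl (run_from D (sp_end r) rs)"
    by (simp add: run_from_def flip: append_Cons)
  show "last (route r) = hd (run_from D (sp_end r) rs)" using R(3) by simp
qed

lemma run_from_drives: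
  assumes V: "valid_data D" and "set rs \<subseteq> subpaths D" "walk sp_start sp_end k rs m" "k \<in> set (checkpoints D)"
  shows "drives D (run_from D k rs) \<and> last (run_from D k rs) = (m, sched D m)"
  using assms(2-)
proof (induction rs arbitrary: k)
  case Nil
  then show ?case using V by (auto simp: drives_def valid_data_def)
next
  case (Cons r rs)
  then have r: "r \<in> subpaths D" "sp_start r = k" by auto
  have IH: "drives D (run_from D (sp_end r) rs)" "last (run_from D (sp_end r) rs) = (m, sched D m)"
    using Cons subpath_ends[OF V r(1)] by auto
  note run = run_from_Cons[OF r, of rs]
  have "drives D (route r @ tl (run_from D (sp_end r) rs))"
    using drives_append[OF subpath_drives[OF V r(1)] IH(1)] run subpath_route(4)[OF r(1)] by simp
  moreover have "last (route r @ tl (run_from D (sp_end r) rs)) = last (run_from D (sp_end r) rs)"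
    using run(2) by (cases "run_from D (sp_end r) rs") auto
  ultimately show ?case using IH(2) run(1) by simp
qed

lemma route_subset_run:
  assumes "set rs \<subseteq> subpaths D" "walk sp_start sp_end k rs m" "r \<in> set rs"
  shows "set (route r) \<subseteq> set (run_from D k rs)"
  using assms
proof (induction rs arbitrary: k)
  case (Cons q rs)
  then have q: "q \<in> subpaths D" "sp_start q = k" by auto
  have "set (run_from D (sp_end q) rs) \<subseteq> set (run_from D k (q # rs))"
    using run_from_Cons[OF q, of rs] last_in_set[OF subpath_route(4)[OF q(1)]]
    by (cases "run_from D (sp_end q) rs") auto
  then show ?case using Cons run_from_Cons(1)[OF q, of rs] by fastforce
qed simp

text \<open>
  A trip visits a checkpoint in every window of \<open>max_skip D + 1\<close> consecutive checkpoints: a subpath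
  that starts before the window cannot jump beyond it.
\<close>

lemma run_from_window:
  assumes V: "valid_data D" and "set rs \<subseteq> subpaths D"
    "walk sp_start sp_end (checkpoints D ! a) rs (destination D)" "a < length (checkpoints D)"
    "n + max_skip D < length (checkpoints D)" "a \<le> n + max_skip D"
  shows "\<exists>m\<in>{n..n + max_skip D}. checkpoints D ! m \<in> fst ` set (run_from D (checkpoints D ! a) rs)"
  using assms(2-)
proof (induction rs arbitrary: a)
  case Nil
  have "length (checkpoints D) - 1 < length (checkpoints D)" using Nil(3) by linarith
  then have "\<not> a < length (checkpoints D) - 1"
    using checkpoint_nth_less[OF V, of a "length (checkpoints D) - 1"] Nil(2)
    by (auto simp: destination_conv_nth[OF V])
  then show ?case using Nil by (intro bexI[of _ a]) auto
next
  case (Cons r rs)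
  show ?case
  proof (cases "n \<le> a")
    case True
    then show ?thesis using Cons.prems by (intro bexI[of _ a]) (auto simp: run_from_def)
  next
    case False
    have r: "r \<in> subpaths D" "sp_start r = checkpoints D ! a" using Cons.prems by auto
    then obtain a' b where ab: "a' < b" "b < length (checkpoints D)" "b - a' - 1 \<le> max_skip D"
      "sp_start r = checkpoints D ! a'" "sp_end r = checkpoints D ! b" by (auto simp: subpaths_def)
    have "a' = a"
      using checkpoint_nth_less[OF V, of a a'] checkpoint_nth_less[OF V, of a' a] r(2) ab Cons.prems(3)
      by (metis less_irrefl linorder_neqE_nat order_less_trans)
    then have "b \<le> n + max_skip D" using ab False by linarith
    then have "\<exists>m\<in>{n..n + max_skip D}. checkpoints D ! m \<in> fst ` set (run_from D (checkpoints D ! b) rs)"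
      using Cons.prems ab by (intro Cons.IH) auto
    then obtain m where m: "m \<in> {n..n + max_skip D}"
      "checkpoints D ! m \<in> fst ` set (run_from D (checkpoints D ! b) rs)" by blast
    have "set (run_from D (sp_end r) rs) \<subseteq> set (run_from D (checkpoints D ! a) (r # rs))"
      using run_from_Cons[OF r, of rs] last_in_set[OF subpath_route(4)[OF r(1)]]
      by (cases "run_from D (sp_end r) rs") auto
    then show ?thesis using m ab by (intro bexI[of _ m]) auto
  qed
qed

text \<open>
  A checkpoint shared by two consecutive subpaths has both an incoming and an outgoing leg, so its
  degree pays for a pickup in either subpath.
\<close>

lemma run_from_degree:
  assumes "set rs \<subseteq> subpaths D" "walk sp_start sp_end k rs m"
  shows "length (filter (\<lambda>r. i \<in> set (sp_locs r)) rs) \<le> degree i (adj (map fst (run_from D k rs)))"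
  using assms
proof (induction rs arbitrary: k)
  case (Cons r rs)
  then have r: "r \<in> subpaths D" "sp_start r = k" by auto
  note run = run_from_Cons[OF r, of rs]
  have "adj (map fst (run_from D k (r # rs))) = adj (sp_locs r) @ adj (map fst (run_from D (sp_end r) rs))"
    unfolding run(1) map_append map_tl sp_locs_def
    using run(2) subpath_route(4)[OF r(1)] by (intro adj_append) (simp_all add: last_map hd_map)
  moreover have "2 \<le> length (sp_locs r)" using subpath_route(1)[OF r(1)] by (simp add: sp_locs_def)
  moreover have "length (filter (\<lambda>r. i \<in> set (sp_locs r)) rs)
      \<le> degree i (adj (map fst (run_from D (sp_end r) rs)))" using Cons by auto
  ultimately show ?case using r degree_adj(1)[of "sp_locs r" i] by auto
qed simp

lemma run_from_stops: "map fst (run_from D (origin D) rs) = trip_stops D rs"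
  by (simp add: run_from_def trip_stops_def sp_locs_def map_concat o_def map_tl)

section \<open>Pickups and costs\<close>

text \<open>
  The sum of \<open>g\<close> over the pickups (location and time) of the request \<open>p\<close> in the subpaths \<open>rs\<close>.
  Costs, loads, pickup times and assignment variables of a trip are all of this form.
\<close>

definition pickup_total :: "('l \<times> real \<Rightarrow> real) \<Rightarrow> 'p \<Rightarrow> ('l, 'p) subpath list \<Rightarrow> real" where
  "pickup_total g p rs = (\<Sum>r\<leftarrow>rs. case pickup r p of None \<Rightarrow> 0 | Some s \<Rightarrow> g s)"

lemma pickup_total_Nil [simp]: "pickup_total g p [] = 0"
  by (simp add: pickup_total_def)

lemma pickup_total_Cons:
  "pickup_total g p (r # rs) = (case pickup r p of None \<Rightarrow> 0 | Some s \<Rightarrow> g s) + pickup_total g p rs"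
  by (simp add: pickup_total_def)

lemma pickup_total_add: "pickup_total (\<lambda>s. f s + g s) p rs = pickup_total f p rs + pickup_total g p rs"
  by (induction rs) (auto simp: pickup_total_Cons split: option.splits)

lemma pickup_total_cmult: "pickup_total (\<lambda>s. c * f s) p rs = c * pickup_total f p rs"
  by (induction rs) (auto simp: pickup_total_Cons algebra_simps split: option.splits)

lemma pickup_total_mono:
  assumes "\<And>r s. r \<in> set rs \<Longrightarrow> pickup r p = Some s \<Longrightarrow> f s \<le> g s"
  shows "pickup_total f p rs \<le> pickup_total g p rs"
  unfolding pickup_total_def by (intro sum_list_mono) (auto split: option.splits intro: assms)

lemma pickup_total_nonneg:
  assumes "\<And>r s. r \<in> set rs \<Longrightarrow> pickup r p = Some s \<Longrightarrow> 0 \<le> f s"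
  shows "0 \<le> pickup_total f p rs"
  unfolding pickup_total_def by (intro sum_list_nonneg) (auto split: option.splits intro: assms)

lemma pickup_total_one: "pickup_total (\<lambda>_. 1) p rs = real (times_served p rs)"
  by (induction rs) (auto simp: pickup_total_Cons times_served_def served_def split: option.splits)

lemma pickup_total_sum:
  assumes "finite A" "\<And>r s. r \<in> set rs \<Longrightarrow> pickup r p = Some s \<Longrightarrow> fst s \<in> A"
  shows "(\<Sum>i\<in>A. g i * pickup_total (\<lambda>s. of_bool (fst s = i)) p rs) = pickup_total (\<lambda>s. g (fst s)) p rs"
  using assms(2)
proof (induction rs)
  case (Cons r rs)
  have "(\<Sum>i\<in>A. g i * (case pickup r p of None \<Rightarrow> 0 | Some s \<Rightarrow> of_bool (fst s = i)))
      = (case pickup r p of None \<Rightarrow> 0 | Some s \<Rightarrow> g (fst s))"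
  proof (cases "pickup r p")
    case (Some s)
    then have "fst s \<in> A" using Cons.prems[of r s] by simp
    have "(\<Sum>i\<in>A. g i * of_bool (fst s = i)) = (\<Sum>i\<in>A. if i = fst s then g i else 0)"
      by (intro sum.cong) auto
    also have "\<dots> = g (fst s)" using \<open>fst s \<in> A\<close> assms(1) by simp
    finally show ?thesis using Some by simp
  qed simp
  moreover have "(\<Sum>i\<in>A. g i * pickup_total (\<lambda>s. of_bool (fst s = i)) p rs)
      = pickup_total (\<lambda>s. g (fst s)) p rs" using Cons by auto
  ultimately show ?case by (simp add: pickup_total_Cons distrib_left sum.distrib)
qed simp

text \<open>
  The compact objective is linear in the variables \<open>cw\<close> and \<open>t_pick\<close>. Up to the factor
  \<open>passengers D p\<close>, these are the coefficients of \<open>cw S p i\<close> and of \<open>t_pick S p\<close>. The second may be negative.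
\<close>

definition assign_rate :: "('l, 'p) trip_data \<Rightarrow> 'p \<Rightarrow> 'l \<Rightarrow> real" where
  "assign_rate D p i = w_walk D * t_walk D i p - w_wait D * (t_req D p + t_walk D i p)
     + w_travel D / t_dir D p * t_drop D
     + (w_delay D * (t_late D p / t_dir D p) + w_delay D / 2 * (t_early D p / t_dir D p)) - reward D"

definition time_rate :: "('l, 'p) trip_data \<Rightarrow> 'p \<Rightarrow> real" where
  "time_rate D p = w_wait D - w_travel D / t_dir D p"

lemma compact_cost_rates:
  "compact_cost D S = (\<Sum>p\<in>requests D. real (passengers D p) *
     ((\<Sum>i\<in>pick_locs D p. assign_rate D p i * cw S p i) + time_rate D p * t_pick S p))"
proof -
  have "(\<Sum>i\<in>A. (a i - b i + c + d - e) * w i) =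
     (\<Sum>i\<in>A. a i * w i) - (\<Sum>i\<in>A. b i * w i) + c * (\<Sum>i\<in>A. w i) + d * (\<Sum>i\<in>A. w i) - e * (\<Sum>i\<in>A. w i)"
    for A :: "'a set" and a b w :: "'a \<Rightarrow> real" and c d e :: real
    by (simp add: algebra_simps sum.distrib sum_subtractf sum_distrib_left)
  note split = this
  have ring: "l * A + m * (T - B) + c * (h * W - T) + d * W - e * W
      = l * A - m * B + c * h * W + d * W - e * W + (m - c) * T"
    for l m c d e h A B W T :: real by (simp add: algebra_simps)
  show ?thesis
    unfolding compact_cost_def assign_rate_def time_rate_def split
    by (intro sum.cong refl arg_cong2[where f = "(*)"]) (simp only: mult.assoc[of _ "t_walk _ _ _"]
      mult.assoc[of _ "_ + _"] sum_distrib_left[symmetric] ring)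
qed

lemma pickup_cost_rates: "pickup_cost D p s = assign_rate D p (fst s) + time_rate D p * snd s"
  by (cases s) (simp add: pickup_cost_def assign_rate_def time_rate_def diff_divide_distrib algebra_simps)

lemma sum_list_sum: "(\<Sum>r\<leftarrow>rs. \<Sum>p\<in>A. f r p) = (\<Sum>p\<in>A. \<Sum>r\<leftarrow>rs. (f r p :: real))"
  by (induction rs) (simp_all add: sum.distrib)

lemma served_sum:
  assumes "valid_data D" "r \<in> subpaths D"
  shows "(\<Sum>p\<in>served r. f p (the (pickup r p)))
    = (\<Sum>p\<in>requests D. case pickup r p of None \<Rightarrow> 0 | Some s \<Rightarrow> (f p s :: real))"
proof -
  have "served r \<subseteq> requests D" using assms(2) by (auto simp: subpaths_def)
  moreover have "finite (requests D)" using assms(1) by (simp add: valid_data_def)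
  ultimately show ?thesis
    by (intro sum.mono_neutral_cong_left) (auto simp: served_def split: option.splits)
qed

lemma trip_cost:
  assumes "valid_data D" "set rs \<subseteq> subpaths D"
  shows "(\<Sum>r\<leftarrow>rs. subpath_cost D r)
    = (\<Sum>p\<in>requests D. real (passengers D p) * pickup_total (pickup_cost D p) p rs)"
proof -
  have "(\<Sum>r\<leftarrow>rs. subpath_cost D r) = (\<Sum>r\<leftarrow>rs. \<Sum>p\<in>requests D.
      case pickup r p of None \<Rightarrow> 0 | Some s \<Rightarrow> real (passengers D p) * pickup_cost D p s)"
    using assms served_sum[OF assms(1), where f = "\<lambda>p s. real (passengers D p) * pickup_cost D p s"]
    by (intro arg_cong[where f = sum_list] map_cong) (auto simp: subpath_cost_def)
  then show ?thesis by (simp add: sum_list_sum flip: pickup_total_def pickup_total_cmult)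
qed

lemma trip_load:
  assumes "valid_data D" "set rs \<subseteq> subpaths D"
  shows "real (\<Sum>r\<leftarrow>rs. load D r) = (\<Sum>p\<in>requests D. real (passengers D p) * real (times_served p rs))"
proof -
  have "real (\<Sum>r\<leftarrow>rs. load D r) = (\<Sum>r\<leftarrow>rs. real (load D r))" by (induction rs) auto
  also have "\<dots> = (\<Sum>r\<leftarrow>rs. \<Sum>p\<in>requests D. case pickup r p of None \<Rightarrow> 0 | Some s \<Rightarrow> real (passengers D p) * 1)"
    using assms served_sum[OF assms(1), where f = "\<lambda>p s. real (passengers D p) * 1"]
    by (intro arg_cong[where f = sum_list] map_cong) (auto simp: load_def)
  also have "\<dots> = (\<Sum>p\<in>requests D. real (passengers D p) * pickup_total (\<lambda>_. 1) p rs)"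
    by (simp only: sum_list_sum pickup_total_def[symmetric] pickup_total_cmult[symmetric])
  finally show ?thesis by (simp add: pickup_total_one)
qed

section \<open>The compact solution of a trip\<close>

lemma out_sum: "legs D \<subseteq> stations D \<times> stations D \<Longrightarrow>
    (\<Sum>j\<in>next_locs D i. f i j) = (\<Sum>a\<in>{a \<in> legs D. fst a = i}. f (fst a) (snd a))"
  by (rule sum.reindex_bij_witness[of _ snd "Pair i"]) (auto simp: next_locs_def)

lemma in_sum: "legs D \<subseteq> stations D \<times> stations D \<Longrightarrow>
    (\<Sum>j\<in>prev_locs D i. f j i) = (\<Sum>a\<in>{a \<in> legs D. snd a = i}. f (fst a) (snd a))"
  by (rule sum.reindex_bij_witness[of _ fst "\<lambda>j. (j, i)"]) (auto simp: prev_locs_def)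

text \<open>
  The compact solution that follows the stops of the trip \<open>rs\<close>. Stop times at locations not visited
  are \<open>0\<close>. If \<open>p\<close> is picked up several times, then \<open>cw\<close> counts the pickups and \<open>t_pick\<close> adds up their
  times, which keeps the cost equal to that of the trip.
\<close>

definition trip_point :: "('l, 'p) trip_data \<Rightarrow> ('l, 'p) subpath list \<Rightarrow> ('l, 'p) compact_vars" where
  "trip_point D rs =
    \<lparr>cv = \<lambda>i. of_bool (i \<in> set (trip_stops D rs)),
     cy = \<lambda>i j. real (count_list (adj (trip_stops D rs)) (i, j)),
     cw = \<lambda>p i. pickup_total (\<lambda>s. of_bool (fst s = i)) p rs,
     t_stop = \<lambda>i. case map_of (run_from D (origin D) rs) i of None \<Rightarrow> 0 | Some t \<Rightarrow> t,
     t_pick = \<lambda>p. pickup_total snd p rs\<rparr>"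

text \<open>
  A trip that visits no stop twice.
\<close>

locale single_trip =
  fixes D :: "('l, 'p) trip_data" and rs
  assumes valid: "valid_data D" and big_M: "valid_big_M D"
    and trip: "is_trip D rs" and once: "distinct (trip_stops D rs)"
begin

abbreviation "S \<equiv> trip_point D rs"
abbreviation "run \<equiv> run_from D (origin D) rs"
abbreviation "stops \<equiv> trip_stops D rs"

lemma trip_walk: "set rs \<subseteq> subpaths D" "walk sp_start sp_end (origin D) rs (destination D)"
  "(\<Sum>r\<leftarrow>rs. load D r) \<le> capacity D"
  using trip by (auto simp: is_trip_iff[OF valid])

lemma run_drives: "drives D run" "last run = (destination D, sched D (destination D))"
  using run_from_drives[OF valid trip_walk(1,2)] endpoints_in_checkpoints[OF valid] by auto

lemma stops_eq: "stops = map fst run"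
  by (simp add: run_from_stops)

lemma stops_ends: "stops \<noteq> []" "hd stops = origin D" "last stops = destination D" "2 \<le> length stops"
proof -
  show ne: "stops \<noteq> []" and h: "hd stops = origin D" by (simp_all add: trip_stops_def)
  show l: "last stops = destination D" using run_drives(2) by (simp add: stops_eq last_map)
  show "2 \<le> length stops"
    using ne h l origin_neq_destination[OF valid] by (cases stops; cases "tl stops") auto
qed

lemma t_stop_run: "a \<in> set run \<Longrightarrow> t_stop S (fst a) = snd a"
proof -
  assume "a \<in> set run"
  then have a: "map_of run (fst a) = Some (snd a)"
    using once by (intro map_of_is_SomeI) (simp_all add: stops_eq)
  show ?thesis by (simp add: trip_point_def a)
qed

lemma stop_in_run: "i \<in> set stops \<Longrightarrow> (i, t_stop S i) \<in> set run"
  using t_stop_run by (fastforce simp: stops_eq)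

lemma t_stop_unvisited: "i \<notin> set stops \<Longrightarrow> t_stop S i = 0"
proof -
  assume "i \<notin> set stops"
  then have "map_of run i = None" by (simp add: stops_eq map_of_eq_None_iff)
  then show ?thesis by (simp add: trip_point_def)
qed

lemma sched_origin_nonneg: "0 \<le> sched D (origin D)"
  using valid by (simp add: valid_data_def)

lemma run_time: "a \<in> set run \<Longrightarrow> sched D (origin D) \<le> snd a \<and> snd a \<le> sched D (destination D)"
  using drives_bounds[OF valid run_drives(1)] run_drives(2) by (metis run_from_nonempty(2) snd_conv)

lemma t_stop_bounds: "0 \<le> t_stop S i" "t_stop S i \<le> sched D (destination D)"
  using run_time[OF stop_in_run, of i] t_stop_unvisited[of i] sched_origin_nonneg origin_less_destination[OF valid]
  by (cases "i \<in> set stops"; simp)+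

lemma t_stop_checkpoint: "i \<in> set stops \<Longrightarrow> i \<in> set (checkpoints D) \<Longrightarrow> t_stop S i = sched D i"
  using stop_in_run[of i] run_drives(1) by (fastforce simp: drives_def)

lemma adj_stops:
  assumes "(i, j) \<in> set (adj stops)"
  shows "(i, j) \<in> legs D" "t_stop S i + tt D i j \<le> t_stop S j"
    "j \<notin> set (checkpoints D) \<Longrightarrow> t_stop S j = t_stop S i + tt D i j"
proof -
  obtain a b where ab: "(a, b) \<in> set (adj run)" "i = fst a" "j = fst b"
    using assms by (auto simp: stops_eq adj_map)
  have "a \<in> set run" "b \<in> set run"
    using ab(1) set_zip_leftD[of a b] set_zip_rightD[of a b run "tl run"]
    by (auto simp: adj_def) (metis list.set_sel(2) run_from_nonempty(1))
  then have t: "t_stop S i = snd a" "t_stop S j = snd b" using t_stop_run ab by auto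
  have "(\<lambda>(i, s) (j, t). j \<in> next_locs D i \<and> s + tt D i j \<le> t \<and>
       (j \<notin> set (checkpoints D) \<longrightarrow> t = s + tt D i j)) a b"
    using run_drives(1) ab(1) unfolding drives_def successively_adj by fastforce
  then show "(i, j) \<in> legs D" "t_stop S i + tt D i j \<le> t_stop S j"
    "j \<notin> set (checkpoints D) \<Longrightarrow> t_stop S j = t_stop S i + tt D i j"
    using ab t by (auto simp: case_prod_beta next_locs_def)
qed

lemma adj_stops_legs: "set (adj stops) \<subseteq> legs D"
  using adj_stops(1) by auto

lemma legs_finite: "legs D \<subseteq> stations D \<times> stations D" "finite (legs D)"
  using valid unfolding valid_data_def by (meson finite_SigmaI finite_subset)+

lemma cy_eq: "cy S i j = real (count_list (adj stops) (i, j))"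
  by (simp add: trip_point_def)

lemma cy_binary: "cy S i j \<in> {0, 1}"
  using adj_distinct[OF once] by (auto simp: cy_eq count_list_distinct)

lemma out_count: "(\<Sum>j\<in>next_locs D i. cy S i j) = (\<Sum>a\<in>{a \<in> legs D. fst a = i}. real (count_list (adj stops) a))"
  unfolding out_sum[OF legs_finite(1)] by (intro sum.cong) (auto simp: cy_eq)

lemma in_count: "(\<Sum>j\<in>prev_locs D i. cy S j i) = (\<Sum>a\<in>{a \<in> legs D. snd a = i}. real (count_list (adj stops) a))"
  unfolding in_sum[OF legs_finite(1), of "\<lambda>i. cy S i"] by (intro sum.cong) (auto simp: cy_eq)

lemma balance: "(\<Sum>j\<in>next_locs D i. cy S i j) - (\<Sum>j\<in>prev_locs D i. cy S j i)
    = (if i = origin D then 1 else if i = destination D then - 1 else 0)"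
  unfolding out_count in_count
  using excess_walk[OF legs_finite(2) adj_stops_legs walk_adj[OF stops_ends(1)], of i]
    stops_ends origin_neq_destination[OF valid]
  by (auto simp: excess_def)

lemma throughput_eq: "throughput D S i = real (degree i (adj stops))"
  unfolding throughput_def out_count in_count
  by (simp add: degree_def sum_count_list_length[OF legs_finite(2) adj_stops_legs])

lemma throughput_visited: "i \<in> set stops \<Longrightarrow> 1 \<le> throughput D S i"
  and throughput_unvisited: "i \<notin> set stops \<Longrightarrow> throughput D S i = 0"
  using degree_adj[OF stops_ends(4), of i] by (simp_all add: throughput_eq)

lemma pickup_props:
  assumes "r \<in> set rs" "pickup r p = Some s"
  shows "s \<in> set run" "fst s \<in> pick_locs D p" "acceptable D p (fst s) (snd s)" "p \<in> requests D"
    "compatible D p" "fst s \<in> set (sp_locs r)" "fst s \<in> set stops" "t_stop S (fst s) = snd s" "0 \<le> snd s"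
proof -
  have r: "r \<in> subpaths D" using assms(1) trip_walk(1) by auto
  have s: "s \<in> set (route r) \<and> fst s \<in> pick_locs D p \<and> acceptable D p (fst s) (snd s)"
    using r assms(2) unfolding subpaths_def by (cases s) auto
  then show "fst s \<in> pick_locs D p" "acceptable D p (fst s) (snd s)" by auto
  show "fst s \<in> set (sp_locs r)" using s by (simp add: sp_locs_def)
  show run: "s \<in> set run" using route_subset_run[OF trip_walk(1,2) assms(1)] s by auto
  then show "t_stop S (fst s) = snd s" by (rule t_stop_run)
  show "fst s \<in> set stops" using run by (simp add: stops_eq)
  show "0 \<le> snd s" using run_time[OF run] sched_origin_nonneg by simp
  have "p \<in> served r" using assms(2) by (auto simp: served_def)
  then show "p \<in> requests D" "compatible D p" using r by (auto simp: subpaths_def)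
qed

lemma cw_eq: "cw S p i = pickup_total (\<lambda>s. of_bool (fst s = i)) p rs"
  and t_pick_eq: "t_pick S p = pickup_total snd p rs"
  by (simp_all add: trip_point_def)

lemma cw_nonneg: "0 \<le> cw S p i"
  unfolding cw_eq by (rule pickup_total_nonneg) simp

lemma pickup_total_zero:
  assumes "\<And>r s. r \<in> set rs \<Longrightarrow> pickup r p = Some s \<Longrightarrow> f s = 0"
  shows "pickup_total f p rs = 0"
proof -
  have "map (\<lambda>r. case pickup r p of None \<Rightarrow> 0 | Some s \<Rightarrow> f s) rs = map (\<lambda>_. 0) rs"
    using assms by (intro map_cong) (simp_all split: option.splits)
  from arg_cong[OF this, of sum_list] show ?thesis by (simp add: pickup_total_def)
qed

lemma cw_outside: "i \<notin> pick_locs D p \<or> i \<notin> set stops \<Longrightarrow> cw S p i = 0"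
  unfolding cw_eq using pickup_props(2,7) by (intro pickup_total_zero) auto

lemma cw_le_count: "cw S p i \<le> real (length (filter (\<lambda>r. i \<in> set (sp_locs r)) rs))"
proof -
  have "pickup_total (\<lambda>s. of_bool (fst s = i)) p qs \<le> real (length (filter (\<lambda>r. i \<in> set (sp_locs r)) qs))"
    if "set qs \<subseteq> set rs" for qs
    using that
  proof (induction qs)
    case (Cons q qs)
    have "(case pickup q p of None \<Rightarrow> 0 | Some s \<Rightarrow> of_bool (fst s = i)) \<le> (of_bool (i \<in> set (sp_locs q)) :: real)"
      using pickup_props(6)[of q p] Cons.prems by (auto split: option.splits)
    then show ?case using Cons by (auto simp: pickup_total_Cons)
  qed simp
  then show ?thesis by (simp add: cw_eq)
qed

lemma cw_le_throughput: "cw S p i \<le> throughput D S i"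
  using cw_le_count[of p i] run_from_degree[OF trip_walk(1,2), of i]
  by (simp add: throughput_eq stops_eq)

text \<open>
  Two pickups of a request at one location need two subpaths of the trip that both stop there. Since
  stops are not repeated, that location is a checkpoint.
\<close>

lemma cw_le_one:
  assumes "i \<notin> set (checkpoints D)"
  shows "cw S p i \<le> 1"
proof -
  have "length (filter (\<lambda>r. i \<in> set (sp_locs r)) qs) \<le> count_list (concat (map (\<lambda>r. tl (sp_locs r)) qs)) i"
    if "set qs \<subseteq> set rs" for qs
    using that
  proof (induction qs)
    case (Cons q qs)
    have "sp_start q \<noteq> i" using Cons.prems trip_walk(1) subpath_ends(1)[OF valid, of q] assms by auto
    then have "i \<in> set (tl (sp_locs q))" if "i \<in> set (sp_locs q)"
      using that by (cases "sp_locs q") (auto simp: sp_start_def)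
    then have "i \<in> set (sp_locs q) \<Longrightarrow> 1 \<le> count_list (tl (sp_locs q)) i"
      by (metis count_list_0_iff less_one not_less)
    then show ?case using Cons by auto
  qed simp
  from this[of rs] have "length (filter (\<lambda>r. i \<in> set (sp_locs r)) rs)
      \<le> count_list (concat (map (\<lambda>r. tl (sp_locs r)) rs)) i" by simp
  also have "\<dots> \<le> 1"
    using once by (simp add: trip_stops_def count_list_distinct)
  finally show ?thesis using cw_le_count[of p i] by linarith
qed

lemma pick_locs_finite: "p \<in> requests D \<Longrightarrow> finite (pick_locs D p)"
  using valid finite_subset[of "pick_locs D p" "stations D"] by (fastforce simp: valid_data_def)

lemma cw_sum:
  assumes "p \<in> requests D"
  shows "(\<Sum>i\<in>pick_locs D p. g i * cw S p i) = pickup_total (\<lambda>s. g (fst s)) p rs"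
  unfolding cw_eq by (rule pickup_total_sum[OF pick_locs_finite[OF assms]]) (rule pickup_props(2))

lemma cw_total: "p \<in> requests D \<Longrightarrow> (\<Sum>i\<in>pick_locs D p. cw S p i) = real (times_served p rs)"
  using cw_sum[of p "\<lambda>_. 1"] by (simp add: pickup_total_one)

lemma cost: "compact_cost D S = (\<Sum>r\<leftarrow>rs. subpath_cost D r)"
  unfolding compact_cost_rates trip_cost[OF valid trip_walk(1)]
proof (intro sum.cong refl arg_cong2[where f = "(*)"])
  fix p assume "p \<in> requests D"
  then show "(\<Sum>i\<in>pick_locs D p. assign_rate D p i * cw S p i) + time_rate D p * t_pick S p
      = pickup_total (pickup_cost D p) p rs"
    by (simp add: cw_sum t_pick_eq pickup_total_add pickup_cost_rates[abs_def] flip: pickup_total_cmult)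
qed

lemma capacity_bound:
  "(\<Sum>p\<in>requests D. \<Sum>i\<in>pick_locs D p. real (passengers D p) * cw S p i) \<le> real (capacity D)"
proof -
  have "(\<Sum>p\<in>requests D. \<Sum>i\<in>pick_locs D p. real (passengers D p) * cw S p i)
      = (\<Sum>p\<in>requests D. real (passengers D p) * real (times_served p rs))"
    by (intro sum.cong refl) (simp add: cw_total flip: sum_distrib_left)
  then show ?thesis using trip_walk(3) trip_load[OF valid trip_walk(1)] by linarith
qed

lemma t_pick_nonneg: "0 \<le> t_pick S p"
  unfolding t_pick_eq using pickup_props(9) by (intro pickup_total_nonneg) auto

lemma t_pick_ge: "cw S p i * t_stop S i \<le> t_pick S p"
proof -
  have "pickup_total (\<lambda>s. t_stop S i * of_bool (fst s = i)) p rs \<le> pickup_total snd p rs"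
    using pickup_props(8,9) by (intro pickup_total_mono) (auto simp: of_bool_def)
  then show ?thesis by (simp add: pickup_total_cmult cw_eq t_pick_eq mult.commute)
qed

lemma M_bounds: "sched D (destination D) \<le> M_stop D" "sched D (destination D) \<le> M_T D"
  "sched D (destination D) \<le> M_y D" "(i, j) \<in> legs D \<Longrightarrow> sched D (destination D) + tt D i j \<le> M_stop D"
  using big_M by (auto simp: valid_big_M_def)

text \<open>
  The coefficient of \<open>1 - cw S p i\<close> in a lower bound, common to all trips, on the slack of the
  constraint that links the pickup time of \<open>p\<close> to the stop time at \<open>i\<close>.
\<close>

definition slack :: "'l \<Rightarrow> real" where
  "slack i = (if i \<in> set (checkpoints D) then M_stop D - sched D i else 0)"

text \<open>
  If \<open>p\<close> is picked up twice at a checkpoint \<open>i\<close>, then \<open>1 - cw S p i\<close> is negative and the right-hand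
  side can be negative as well. Because \<open>slack i\<close> does not depend on the trip, the bound can be
  averaged over trips, after which \<open>1 - cw\<close> is nonnegative for every request.
\<close>

lemma t_pick_slack:
  "slack i * (1 - cw S p i) \<le> t_pick S p - t_stop S i + M_stop D * (1 - cw S p i)"
proof (cases "i \<in> set (checkpoints D)")
  case cp: True
  show ?thesis
  proof (cases "i \<in> set stops")
    case True
    then show ?thesis using t_pick_ge[of p i] cp t_stop_checkpoint by (simp add: slack_def algebra_simps)
  next
    case False
    have "0 \<le> sched D i" using sched_bounds(1)[OF valid cp] sched_origin_nonneg by simp
    then show ?thesis
      using False cp t_stop_unvisited[of i] cw_outside[of i p] t_pick_nonneg[of p] by (simp add: slack_def)
  qed
next
  case False
  have "0 \<le> (1 - cw S p i) * (M_stop D - t_stop S i)"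
    using cw_le_one[OF False, of p] t_stop_bounds(2)[of i] M_bounds(1) by (intro mult_nonneg_nonneg) auto
  then show ?thesis using t_pick_ge[of p i] False by (simp add: slack_def algebra_simps)
qed

lemma leg_time:
  assumes "(i, j) \<in> legs D"
  shows "t_stop S i + tt D i j - M_stop D * (1 - cy S i j) \<le> t_stop S j"
proof (cases "(i, j) \<in> set (adj stops)")
  case True
  then have "cy S i j = 1" using adj_distinct[OF once] by (simp add: cy_eq count_list_distinct)
  then show ?thesis using adj_stops(2)[OF True] by simp
next
  case False
  then have "cy S i j = 0" by (simp add: cy_eq)
  then show ?thesis using M_bounds(4)[OF assms] t_stop_bounds(2)[of i] t_stop_bounds(1)[of j] by simp
qed

lemma checkpoint_time:
  assumes "i \<in> set (checkpoints D)"
  shows "sched D i - M_T D * (1 - cv S i) \<le> t_stop S i" "t_stop S i \<le> sched D i + M_T D * (1 - cv S i)"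
proof -
  have cv: "cv S i = of_bool (i \<in> set stops)" by (simp add: trip_point_def)
  have "0 \<le> sched D i" "sched D i \<le> M_T D"
    using sched_bounds[OF valid assms] sched_origin_nonneg M_bounds(2) by auto
  then show "sched D i - M_T D * (1 - cv S i) \<le> t_stop S i" "t_stop S i \<le> sched D i + M_T D * (1 - cv S i)"
    using t_stop_checkpoint[OF _ assms] t_stop_unvisited[of i] cv by (cases "i \<in> set stops"; simp)+
qed

lemma stop_time_throughput: "t_stop S i \<le> M_y D * throughput D S i"
proof (cases "i \<in> set stops")
  case True
  have "0 \<le> M_y D" using M_bounds(3) t_stop_bounds[of i] by linarith
  then have "M_y D * 1 \<le> M_y D * throughput D S i"
    using throughput_visited[OF True] by (intro mult_left_mono) auto
  then show ?thesis using M_bounds(3) t_stop_bounds(2)[of i] by linarith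
qed (simp add: t_stop_unvisited throughput_unvisited)

lemma cv_throughput: "cv S i \<le> throughput D S i"
  using throughput_visited[of i] throughput_unvisited[of i] by (auto simp: trip_point_def)

lemma cv_window:
  assumes "n + max_skip D < length (checkpoints D)"
  shows "1 \<le> (\<Sum>m = n..n + max_skip D. cv S (checkpoints D ! m))"
proof -
  have "\<exists>m\<in>{n..n + max_skip D}. checkpoints D ! m \<in> set stops"
    using run_from_window[OF valid trip_walk(1), of 0 n] trip_walk(2) assms checkpoints_nonempty[OF valid]
    by (simp add: origin_conv_nth[OF valid, symmetric] stops_eq)
  then obtain m where m: "m \<in> {n..n + max_skip D}" "checkpoints D ! m \<in> set stops" by blast
  then have "1 \<le> cv S (checkpoints D ! m)" by (simp add: trip_point_def)
  also have "\<dots> \<le> (\<Sum>m = n..n + max_skip D. cv S (checkpoints D ! m))"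
    using m(1) by (intro member_le_sum) (auto simp: trip_point_def)
  finally show ?thesis .
qed

lemma trip_operating_rules: "operating_rules D S"
  unfolding operating_rules_def
proof (intro conjI ballI impI)
  fix i assume "i \<in> set (checkpoints D)" "1 \<le> throughput D S i"
  then show "t_stop S i = sched D i" using throughput_unvisited[of i] t_stop_checkpoint by fastforce
next
  fix i j assume "j \<notin> set (checkpoints D) \<and> cy S i j = 1"
  then show "t_stop S j = t_stop S i + tt D i j"
    using adj_stops(3)[of i j] by (metis count_notin cy_eq of_nat_0 zero_neq_one)
next
  fix p i assume p: "cw S p i = 1"
  obtain r s where "r \<in> set rs" "pickup r p = Some s" "fst s = i"
    using p pickup_total_zero[of p "\<lambda>s. of_bool (fst s = i)"] unfolding cw_eq by fastforce
  then show "acceptable D p i (t_stop S i)" using pickup_props(3,8) by metis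
qed

end

section \<open>Convex combinations of trips\<close>

text \<open>
  The sum of \<open>a\<close> with weights \<open>\<theta>\<close>; it is an average when the weights are nonnegative and sum to \<open>1\<close>.
\<close>

definition avg :: "nat \<Rightarrow> (nat \<Rightarrow> real) \<Rightarrow> (nat \<Rightarrow> real) \<Rightarrow> real" where
  "avg n \<theta> a = (\<Sum>k<n. \<theta> k * a k)"

lemma avg_add: "avg n \<theta> (\<lambda>k. a k + b k) = avg n \<theta> a + avg n \<theta> b"
  by (simp add: avg_def distrib_left sum.distrib)

lemma avg_diff: "avg n \<theta> (\<lambda>k. a k - b k) = avg n \<theta> a - avg n \<theta> b"
  by (simp add: avg_def right_diff_distrib sum_subtractf)

lemma avg_cmult: "avg n \<theta> (\<lambda>k. c * a k) = c * avg n \<theta> a"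
  by (simp add: avg_def sum_distrib_left mult_ac)

lemma avg_sum: "avg n \<theta> (\<lambda>k. \<Sum>i\<in>A. f k i) = (\<Sum>i\<in>A. avg n \<theta> (\<lambda>k. f k i))"
  unfolding avg_def by (simp add: sum_distrib_left) (rule sum.swap)

lemma avg_const: "(\<Sum>k<n. \<theta> k) = 1 \<Longrightarrow> avg n \<theta> (\<lambda>k. c) = c"
  by (simp add: avg_def flip: sum_distrib_right)

lemma avg_mono: "(\<And>k. k < n \<Longrightarrow> 0 \<le> \<theta> k) \<Longrightarrow> (\<And>k. k < n \<Longrightarrow> a k \<le> b k) \<Longrightarrow> avg n \<theta> a \<le> avg n \<theta> b"
  unfolding avg_def by (intro sum_mono mult_left_mono) auto

lemma avg_cong: "(\<And>k. k < n \<Longrightarrow> a k = b k) \<Longrightarrow> avg n \<theta> a = avg n \<theta> b"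
  unfolding avg_def by (intro sum.cong) auto

lemma avg_one [simp]: "avg (Suc 0) (\<lambda>_. 1) a = a 0"
  by (simp add: avg_def)

text \<open>
  The combination, variable by variable, of compact solutions with the weights \<open>\<theta>\<close>.
\<close>

definition mixture ::
  "nat \<Rightarrow> (nat \<Rightarrow> real) \<Rightarrow> (nat \<Rightarrow> ('l, 'p) compact_vars) \<Rightarrow> ('l, 'p) compact_vars" where
  "mixture n \<theta> S =
    \<lparr>cv = \<lambda>i. avg n \<theta> (\<lambda>k. cv (S k) i),
     cy = \<lambda>i j. avg n \<theta> (\<lambda>k. cy (S k) i j),
     cw = \<lambda>p i. avg n \<theta> (\<lambda>k. cw (S k) p i),
     t_stop = \<lambda>i. avg n \<theta> (\<lambda>k. t_stop (S k) i),
     t_pick = \<lambda>p. avg n \<theta> (\<lambda>k. t_pick (S k) p)\<rparr>"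

lemma mixture_simps [simp]:
  "cv (mixture n \<theta> S) i = avg n \<theta> (\<lambda>k. cv (S k) i)"
  "cy (mixture n \<theta> S) i j = avg n \<theta> (\<lambda>k. cy (S k) i j)"
  "cw (mixture n \<theta> S) p i = avg n \<theta> (\<lambda>k. cw (S k) p i)"
  "t_stop (mixture n \<theta> S) i = avg n \<theta> (\<lambda>k. t_stop (S k) i)"
  "t_pick (mixture n \<theta> S) p = avg n \<theta> (\<lambda>k. t_pick (S k) p)"
  by (simp_all add: mixture_def)

lemma mixture_throughput: "throughput D (mixture n \<theta> S) i = avg n \<theta> (\<lambda>k. throughput D (S k) i)"
  by (simp add: throughput_def avg_add avg_sum)

lemma mixture_cost: "compact_cost D (mixture n \<theta> S) = avg n \<theta> (\<lambda>k. compact_cost D (S k))"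
  by (simp add: compact_cost_rates avg_sum avg_add avg_cmult)

lemma mixture_one: "mixture 1 (\<lambda>_. 1) (\<lambda>_. S) = S"
  by (simp add: mixture_def)

text \<open>
  All constraints except those on single requests hold for each trip and pass to the convex
  combination by linearity. The bound \<open>served\<close> enters through the assignment constraints, which in
  turn bound the combined \<open>cw\<close> by \<open>1\<close>.
\<close>

lemma mixture_feasible:
  fixes n :: nat and rs :: "nat \<Rightarrow> ('l, 'p) subpath list"
  assumes trips: "\<And>k. k < n \<Longrightarrow> single_trip D (rs k)"
    and nonneg: "\<And>k. k < n \<Longrightarrow> 0 \<le> \<theta> k" and one: "(\<Sum>k<n. \<theta> k) = 1"
    and V: "valid_data D" and M: "valid_big_M D"
    and z: "\<And>p. p \<in> requests D \<Longrightarrow> z p \<le> 1"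
    and served: "\<And>p. p \<in> requests D \<Longrightarrow> avg n \<theta> (\<lambda>k. real (times_served p (rs k))) \<le> z p"
  defines "S \<equiv> \<lambda>k. trip_point D (rs k)"
  shows "compact_constraints D 1 z (mixture n \<theta> S)" "compact_domain D {0..1} (mixture n \<theta> S)"
proof -
  note lin = avg_add avg_diff avg_cmult avg_sum[symmetric] avg_const[OF one] mixture_throughput
  note mono = avg_mono[of n \<theta>, OF nonneg]
  have T: "single_trip D (rs k)" if "k < n" for k using trips that .
  have total: "(\<Sum>i\<in>pick_locs D p. avg n \<theta> (\<lambda>k. cw (S k) p i)) \<le> z p" if "p \<in> requests D" for p
  proof -
    have "(\<Sum>i\<in>pick_locs D p. avg n \<theta> (\<lambda>k. cw (S k) p i)) = avg n \<theta> (\<lambda>k. real (times_served p (rs k)))"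
      unfolding avg_sum[symmetric] using single_trip.cw_total[OF T that] by (intro avg_cong) (simp add: S_def)
    then show ?thesis using served[OF that] by simp
  qed
  have cw0: "0 \<le> avg n \<theta> (\<lambda>k. cw (S k) p i)" for p i
    using mono[of "\<lambda>_. 0" "\<lambda>k. cw (S k) p i"] single_trip.cw_nonneg[OF T] by (simp add: lin S_def)
  have cw1: "avg n \<theta> (\<lambda>k. cw (S k) p i) \<le> 1" if "p \<in> requests D" for p i
  proof (cases "i \<in> pick_locs D p")
    case True
    have "finite (pick_locs D p)"
      using V that finite_subset[of "pick_locs D p" "stations D"] by (fastforce simp: valid_data_def)
    then have "avg n \<theta> (\<lambda>k. cw (S k) p i) \<le> (\<Sum>i\<in>pick_locs D p. avg n \<theta> (\<lambda>k. cw (S k) p i))"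
      using True cw0 by (intro member_le_sum) auto
    then show ?thesis using total[OF that] z[OF that] by linarith
  next
    case False
    then have "avg n \<theta> (\<lambda>k. cw (S k) p i) = avg n \<theta> (\<lambda>_. 0)"
      using single_trip.cw_outside[OF T] by (intro avg_cong) (simp add: S_def)
    then show ?thesis by (simp add: lin)
  qed
  have pick: "t_pick (mixture n \<theta> S) p \<ge> t_stop (mixture n \<theta> S) i - M_stop D * (1 - cw (mixture n \<theta> S) p i)"
    if p: "p \<in> requests D" for p i
  proof -
    \<comment> \<open>This is \<open>slack i\<close>, written without reference to a particular trip.\<close>
    define c where "c = (if i \<in> set (checkpoints D) then M_stop D - sched D i else 0)"
    have "0 \<le> c"
      using M sched_bounds(2)[OF V, of i] by (auto simp: c_def valid_big_M_def)
    then have "0 \<le> c * (1 - avg n \<theta> (\<lambda>k. cw (S k) p i))" using cw1[OF p, of i] by simp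
    also have "\<dots> = avg n \<theta> (\<lambda>k. c * (1 - cw (S k) p i))" by (simp only: lin)
    also have "\<dots> \<le> avg n \<theta> (\<lambda>k. t_pick (S k) p - t_stop (S k) i + M_stop D * (1 - cw (S k) p i))"
    proof (rule mono)
      fix k assume "k < n"
      from single_trip.t_pick_slack[OF T[OF this], of i p]
      show "c * (1 - cw (S k) p i) \<le> t_pick (S k) p - t_stop (S k) i + M_stop D * (1 - cw (S k) p i)"
        by (simp add: S_def c_def single_trip.slack_def[OF T[OF \<open>k < n\<close>]])
    qed
    finally show ?thesis by (simp add: lin)
  qed
  show "compact_constraints D 1 z (mixture n \<theta> S)"
    unfolding compact_constraints_def
  proof (intro conjI ballI allI impI)
    fix i
    have "avg n \<theta> (\<lambda>k. (\<Sum>j\<in>next_locs D i. cy (S k) i j) - (\<Sum>j\<in>prev_locs D i. cy (S k) j i))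
        = avg n \<theta> (\<lambda>k. if i = origin D then 1 else if i = destination D then - 1 else 0)"
      using single_trip.balance[OF T] by (intro avg_cong) (simp add: S_def)
    then show "(\<Sum>j\<in>next_locs D i. cy (mixture n \<theta> S) i j) - (\<Sum>j\<in>prev_locs D i. cy (mixture n \<theta> S) j i) =
        (if i = origin D then 1 else if i = destination D then - 1 else 0)" by (simp add: lin)
  next
    fix i j assume "j \<in> next_locs D i"
    then have "(i, j) \<in> legs D" by (simp add: next_locs_def)
    then have "avg n \<theta> (\<lambda>k. t_stop (S k) i + tt D i j - M_stop D * (1 - cy (S k) i j)) \<le> avg n \<theta> (\<lambda>k. t_stop (S k) j)"
      unfolding S_def by (intro mono single_trip.leg_time T)
    then show "t_stop (mixture n \<theta> S) i + tt D i j - M_stop D * (1 - cy (mixture n \<theta> S) i j)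
        \<le> t_stop (mixture n \<theta> S) j" by (simp add: lin)
  next
    fix p assume "p \<in> requests D"
    then show "(\<Sum>i\<in>pick_locs D p. cw (mixture n \<theta> S) p i) \<le> z p" using total by simp
  next
    have "avg n \<theta> (\<lambda>k. \<Sum>p\<in>requests D. \<Sum>i\<in>pick_locs D p. real (passengers D p) * cw (S k) p i)
        \<le> avg n \<theta> (\<lambda>_. real (capacity D))"
      unfolding S_def by (intro mono single_trip.capacity_bound T)
    then show "(\<Sum>p\<in>requests D. \<Sum>i\<in>pick_locs D p. real (passengers D p) * cw (mixture n \<theta> S) p i)
        \<le> real (capacity D) * 1"
      by (simp only: avg_sum avg_cmult avg_const[OF one] mixture_simps mult_1_right)
  next
    fix p i assume "p \<in> requests D"
    then show "t_stop (mixture n \<theta> S) i - M_stop D * (1 - cw (mixture n \<theta> S) p i) \<le> t_pick (mixture n \<theta> S) p"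
      by (rule pick)
  next
    fix p i
    show "cw (mixture n \<theta> S) p i \<le> throughput D (mixture n \<theta> S) i"
      unfolding mixture_throughput mixture_simps
      unfolding S_def by (intro mono single_trip.cw_le_throughput T)
  next
    fix i assume "i \<in> set (checkpoints D)"
    then have "avg n \<theta> (\<lambda>k. sched D i - M_T D * (1 - cv (S k) i)) \<le> avg n \<theta> (\<lambda>k. t_stop (S k) i)"
      "avg n \<theta> (\<lambda>k. t_stop (S k) i) \<le> avg n \<theta> (\<lambda>k. sched D i + M_T D * (1 - cv (S k) i))"
      using single_trip.checkpoint_time[OF T] by (auto simp: S_def intro!: mono)
    then show "sched D i - M_T D * (1 - cv (mixture n \<theta> S) i) \<le> t_stop (mixture n \<theta> S) i"
      "t_stop (mixture n \<theta> S) i \<le> sched D i + M_T D * (1 - cv (mixture n \<theta> S) i)" by (simp_all add: lin)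
  next
    fix i
    have "avg n \<theta> (\<lambda>k. t_stop (S k) i) \<le> avg n \<theta> (\<lambda>k. M_y D * throughput D (S k) i)"
      unfolding S_def by (intro mono single_trip.stop_time_throughput T)
    then show "t_stop (mixture n \<theta> S) i \<le> M_y D * throughput D (mixture n \<theta> S) i" by (simp add: lin)
    show "cv (mixture n \<theta> S) i \<le> throughput D (mixture n \<theta> S) i"
      unfolding mixture_throughput mixture_simps
      unfolding S_def by (intro mono single_trip.cv_throughput T)
  next
    fix m assume "m + max_skip D < length (checkpoints D)"
    then have "avg n \<theta> (\<lambda>_. 1) \<le> avg n \<theta> (\<lambda>k. \<Sum>h = m..m + max_skip D. cv (S k) (checkpoints D ! h))"
      unfolding S_def by (intro mono single_trip.cv_window T)
    then show "1 \<le> (\<Sum>h = m..m + max_skip D. cv (mixture n \<theta> S) (checkpoints D ! h))" by (simp add: lin)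
  next
    fix i
    show "0 \<le> t_stop (mixture n \<theta> S) i"
      using mono[of "\<lambda>_. 0" "\<lambda>k. t_stop (S k) i"] single_trip.t_stop_bounds(1)[OF T] by (simp add: lin S_def)
  next
    fix p
    show "0 \<le> t_pick (mixture n \<theta> S) p"
      using mono[of "\<lambda>_. 0" "\<lambda>k. t_pick (S k) p"] single_trip.t_pick_nonneg[OF T] by (simp add: lin S_def)
  qed
  have between: "avg n \<theta> a \<in> {0..1}" if "\<And>k. k < n \<Longrightarrow> a k \<in> {0, 1}" for a
  proof -
    have "0 \<le> a k \<and> a k \<le> 1" if "k < n" for k using \<open>\<And>k. k < n \<Longrightarrow> a k \<in> {0, 1}\<close>[OF that] by auto
    then show ?thesis using mono[of "\<lambda>_. 0" a] mono[of a "\<lambda>_. 1"] by (simp add: lin)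
  qed
  show "compact_domain D {0..1} (mixture n \<theta> S)"
    unfolding compact_domain_def mixture_simps
  proof (intro conjI ballI)
    show "avg n \<theta> (\<lambda>k. cv (S k) i) \<in> {0..1}" for i
      by (rule between) (simp add: S_def trip_point_def)
    show "avg n \<theta> (\<lambda>k. cy (S k) i j) \<in> {0..1}" for i j
      unfolding S_def by (rule between) (rule single_trip.cy_binary[OF T])
    show "avg n \<theta> (\<lambda>k. cw (S k) p i) \<in> {0..1}" if "p \<in> requests D" for p i
      using cw0 cw1[OF that] by simp
  qed
qed

lemma zero_feasible:
  assumes V: "valid_data D" and M: "valid_big_M D" and z: "\<And>p. p \<in> requests D \<Longrightarrow> 0 \<le> z p"
  shows "\<exists>S. compact_feasible D 0 z S \<and> operating_rules D S \<and> compact_cost D S = 0"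
proof -
  define S :: "('a, 'b) compact_vars"
    where "S = \<lparr>cv = \<lambda>_. 0, cy = \<lambda>_ _. 0, cw = \<lambda>_ _. 0, t_stop = \<lambda>_. 0, t_pick = \<lambda>_. 0\<rparr>"
  have "0 \<le> sched D k" if "k \<in> set (checkpoints D)" for k
    using sched_bounds(1)[OF V that] V by (simp add: valid_data_def)
  moreover from this have "0 \<le> sched D (destination D)" using endpoints_in_checkpoints[OF V] by blast
  moreover have "sched D k \<le> M_T D" if "k \<in> set (checkpoints D)" for k
    using sched_bounds(2)[OF V that] M by (simp add: valid_big_M_def)
  ultimately have "compact_constraints D 0 z S"
    using M z unfolding compact_constraints_def valid_big_M_def S_def
    by (fastforce simp: throughput_def next_locs_def)
  moreover have "compact_domain D {0, 1} S" "operating_rules D S" "compact_cost D S = 0"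
    by (auto simp: S_def compact_domain_def operating_rules_def throughput_def compact_cost_def)
  ultimately show ?thesis unfolding compact_feasible_def by blast
qed

section \<open>From the network to the compact formulation\<close>

lemma single_trip_intro:
  assumes "valid_data D" "valid_big_M D" "visits_once D" "is_trip D rs"
  shows "single_trip D rs"
  using assms by unfold_locales (auto simp: visits_once_def)

lemma times_served_incompatible:
  assumes "is_trip D rs" "\<not> compatible D p"
  shows "times_served p rs = 0"
  using assms by (auto simp: is_trip_def times_served_def subpaths_def filter_empty_conv)

lemma zero_network:
  assumes V: "valid_data D" and y: "network_constraints D 0 z y" "\<forall>a\<in>arcs D. 0 \<le> y a"
  shows "network_cost D y = 0"
proof -
  have "flow (arcs D) (arc_tail D) (arc_head D) (source D) Sink 0 y"
    using y network_flow_iff[OF V] by blast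
  then have "y a = 0" if "a \<in> arcs D" for a
    using zero_flow[OF finite_arcs[OF V] _ ascending_network[OF V] that] by blast
  then show ?thesis by (simp add: network_cost_def)
qed

lemma compact_feasible_lp: "compact_feasible D x z S \<Longrightarrow> compact_lp_feasible D x z S"
  unfolding compact_feasible_def compact_lp_feasible_def compact_domain_def by fastforce

lemma network_lp_to_compact_lp:
  assumes V: "valid_data D" and M: "valid_big_M D" and fs: "first_stage D x z" and once: "visits_once D"
    and y: "network_lp_feasible D x z y"
  shows "\<exists>S. compact_lp_feasible D x z S \<and> compact_cost D S = network_cost D y"
proof -
  have nn: "\<forall>a\<in>arcs D. 0 \<le> y a" and con: "network_constraints D x z y"
    using y by (auto simp: network_lp_feasible_def)
  have z: "0 \<le> z p" "z p \<le> 1" if "p \<in> requests D" for p using fs that by (auto simp: first_stage_def)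
  consider "x = 0" | "x = 1" using fs by (auto simp: first_stage_def)
  then show ?thesis
  proof cases
    case 1
    obtain S where "compact_feasible D 0 z S" "compact_cost D S = 0"
      using zero_feasible[where z = z, OF V M z(1)] by blast
    then have "compact_lp_feasible D x z S \<and> compact_cost D S = network_cost D y"
      using compact_feasible_lp zero_network[OF V con[unfolded 1] nn] 1 by simp
    then show ?thesis by blast
  next
    case 2
    from network_decomposition[OF V con nn, folded avg_def] obtain n :: nat and \<theta> rs
      where dec: "\<forall>k<n. 0 \<le> \<theta> k \<and> is_trip D (rs k)" "(\<Sum>k<n. \<theta> k) = x"
        "network_cost D y = avg n \<theta> (\<lambda>k. \<Sum>r\<leftarrow>rs k. subpath_cost D r)"
        "\<forall>p\<in>requests D. compatible D p \<longrightarrow> avg n \<theta> (\<lambda>k. real (times_served p (rs k))) \<le> z p"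
      using 2 by auto
    have d: "\<And>k. k < n \<Longrightarrow> 0 \<le> \<theta> k" "\<And>k. k < n \<Longrightarrow> is_trip D (rs k)"
      "(\<Sum>k<n. \<theta> k) = 1" "network_cost D y = avg n \<theta> (\<lambda>k. \<Sum>r\<leftarrow>rs k. subpath_cost D r)"
      "\<And>p. p \<in> requests D \<Longrightarrow> compatible D p \<Longrightarrow> avg n \<theta> (\<lambda>k. real (times_served p (rs k))) \<le> z p"
      using dec 2 by simp_all
    have T: "single_trip D (rs k)" if "k < n" for k
      using single_trip_intro[OF V M once d(2)[OF that]] .
    have "avg n \<theta> (\<lambda>k. real (times_served p (rs k))) \<le> z p" if p: "p \<in> requests D" for p
    proof (cases "compatible D p")
      case False
      then have "avg n \<theta> (\<lambda>k. real (times_served p (rs k))) = avg n \<theta> (\<lambda>_. 0)"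
        using times_served_incompatible[OF d(2)] by (intro avg_cong) simp
      then show ?thesis using z(1)[OF p] avg_const[OF d(3)] by simp
    qed (use d(5) p in simp)
    note feas = mixture_feasible[OF T d(1,3) V M z(2) this]
    have "compact_cost D (mixture n \<theta> (\<lambda>k. trip_point D (rs k))) = network_cost D y"
      unfolding mixture_cost d(4) using single_trip.cost[OF T] by (intro avg_cong) simp
    then show ?thesis using feas 2 unfolding compact_lp_feasible_def by blast
  qed
qed

lemma lp_value_le:
  assumes "valid_data D" "valid_big_M D" "first_stage D x z" "visits_once D"
  shows "compact_lp_value D x z \<le> network_lp_value D x z"
  unfolding network_lp_value_def
proof (rule INF_greatest)
  fix y assume "y \<in> {y. network_lp_feasible D x z y}"
  then obtain S where "compact_lp_feasible D x z S" "compact_cost D S = network_cost D y"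
    using network_lp_to_compact_lp[OF assms] by auto
  then show "compact_lp_value D x z \<le> ereal (network_cost D y)"
    unfolding compact_lp_value_def by (intro INF_lower2[of S]) auto
qed

lemma trip_to_compact:
  assumes V: "valid_data D" and M: "valid_big_M D" and fs: "first_stage D 1 z" and once: "visits_once D"
    and rs: "is_trip D rs" and served: "\<And>p. p \<in> requests D \<Longrightarrow> real (times_served p rs) \<le> z p"
  shows "compact_feasible D 1 z (trip_point D rs)" "operating_rules D (trip_point D rs)"
    "compact_cost D (trip_point D rs) = (\<Sum>r\<leftarrow>rs. subpath_cost D r)"
proof -
  note T = single_trip_intro[OF V M once rs]
  have z: "z p \<le> 1" if "p \<in> requests D" for p using fs that by (auto simp: first_stage_def)
  have "compact_constraints D 1 z (mixture 1 (\<lambda>_. 1) (\<lambda>_. trip_point D rs))"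
    using T served by (intro mixture_feasible V M z) auto
  moreover have "compact_domain D {0, 1} (trip_point D rs)"
    unfolding compact_domain_def
  proof (intro conjI ballI)
    show "cv (trip_point D rs) i \<in> {0, 1}" for i by (simp add: trip_point_def)
    show "cy (trip_point D rs) i j \<in> {0, 1}" for i j by (rule single_trip.cy_binary[OF T])
    show "cw (trip_point D rs) p i \<in> {0, 1}" if p: "p \<in> requests D" for p i
    proof -
      \<comment> \<open>The variable is a count of pickups, and at most one pickup is allowed.\<close>
      have "\<exists>m::nat. pickup_total (\<lambda>s. of_bool (fst s = i)) p rs = real m"
      proof (induction rs)
        case (Cons r rs)
        then obtain m where "pickup_total (\<lambda>s. of_bool (fst s = i)) p rs = real m" by blast
        then show ?case
          by (cases "pickup r p") (auto simp: pickup_total_Cons of_bool_def intro: exI[of _ "Suc m"])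
      qed (auto intro: exI[of _ 0])
      then obtain m :: nat where m: "pickup_total (\<lambda>s. of_bool (fst s = i)) p rs = real m" by blast
      have "pickup_total (\<lambda>s. of_bool (fst s = i)) p rs \<le> pickup_total (\<lambda>_. 1) p rs"
        by (intro pickup_total_mono) simp
      then have "real m \<le> 1" using served[OF p] z[OF p] m by (simp add: pickup_total_one)
      then have "m = 0 \<or> m = 1" by linarith
      then show ?thesis using m by (auto simp: trip_point_def)
    qed
  qed
  ultimately show "compact_feasible D 1 z (trip_point D rs)"
    unfolding mixture_one compact_feasible_def by blast
  show "operating_rules D (trip_point D rs)" by (rule single_trip.trip_operating_rules[OF T])
  show "compact_cost D (trip_point D rs) = (\<Sum>r\<leftarrow>rs. subpath_cost D r)" by (rule single_trip.cost[OF T])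
qed

lemma network_to_compact:
  assumes V: "valid_data D" and M: "valid_big_M D" and fs: "first_stage D x z" and once: "visits_once D"
    and y: "network_feasible D x z y"
  shows "\<exists>S. compact_feasible D x z S \<and> operating_rules D S \<and> compact_cost D S = network_cost D y"
proof -
  have z: "0 \<le> z p" if "p \<in> requests D" for p using fs that by (auto simp: first_stage_def)
  consider "x = 0" | "x = 1" using fs by (auto simp: first_stage_def)
  then show ?thesis
  proof cases
    case 1
    have "\<forall>a\<in>arcs D. 0 \<le> y a" using y by (auto simp: network_feasible_def)
    then have "network_cost D y = 0" using zero_network[OF V] y 1 by (auto simp: network_feasible_def)
    then show ?thesis
      using zero_feasible[where z = z, OF V M z] 1 by simp
  next
    case 2
    obtain rs where rs: "is_trip D rs" "network_cost D y = (\<Sum>r\<leftarrow>rs. subpath_cost D r)"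
      "\<And>p. p \<in> requests D \<Longrightarrow> compatible D p \<Longrightarrow> real (times_served p rs) \<le> z p"
      using binary_network_trip[OF V y[unfolded 2]] by metis
    have "real (times_served p rs) \<le> z p" if "p \<in> requests D" for p
      using rs(3)[OF that] times_served_incompatible[OF rs(1)] z[OF that] by fastforce
    from trip_to_compact[OF V M fs[unfolded 2] once rs(1) this] show ?thesis
      using rs(2) 2 by auto
  qed
qed

section \<open>From the compact formulation to the network\<close>

lemma walk_stops_sorted:
  assumes "walk fst snd n P m" "\<And>a. a \<in> set P \<Longrightarrow> \<phi> (fst a) < (\<phi> (snd a) :: real)"
  shows "sorted_wrt (\<lambda>i j. \<phi> i < \<phi> j) (n # map snd P)"
  using assms
proof (induction P arbitrary: n)
  case (Cons a P)
  then have "sorted_wrt (\<lambda>i j. \<phi> i < \<phi> j) (snd a # map snd P)" "\<phi> n < \<phi> (snd a)" by auto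
  then show ?case by force
qed simp

lemma adj_walk: "walk fst snd n P m \<Longrightarrow> adj (n # map snd P) = P"
  by (induction P arbitrary: n) auto

lemma nth_adj: "Suc h < length ks \<Longrightarrow> adj ks ! h = (ks ! h, ks ! Suc h)"
  by (simp add: adj_def nth_tl)

lemma travel_time_walk:
  assumes "walk fst snd n P m" "\<And>a. a \<in> set P \<Longrightarrow> \<phi> (fst a) + tt D (fst a) (snd a) \<le> \<phi> (snd a)"
  shows "travel_time D (n # map snd P) \<le> \<phi> m - \<phi> n"
  using assms
proof (induction P arbitrary: n)
  case (Cons a P)
  then have "travel_time D (snd a # map snd P) \<le> \<phi> m - \<phi> (snd a)"
    "\<phi> n + tt D n (snd a) \<le> \<phi> (snd a)" by auto
  moreover have "travel_time D (n # map snd (a # P)) = tt D n (snd a) + travel_time D (snd a # map snd P)"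
    by (simp add: travel_time_def sum.lessThan_Suc_shift del: sum.lessThan_Suc)
  ultimately show ?case by simp
qed (simp add: travel_time_def)

text \<open>
  An integral compact solution that obeys the operating rules.
\<close>

locale compact_trip =
  fixes D :: "('l, 'p) trip_data" and x z S
  assumes valid: "valid_data D" and first: "first_stage D x z"
    and feasible: "compact_feasible D x z S" and rules: "operating_rules D S"
begin

lemma constraints: "compact_constraints D x z S" and binary: "compact_domain D {0, 1} S"
  using feasible by (simp_all add: compact_feasible_def)

lemma legs_props: "legs D \<subseteq> stations D \<times> stations D" "finite (legs D)"
  using valid unfolding valid_data_def by (meson finite_SigmaI finite_subset)+

text \<open>
  The leg variables \<open>cy S\<close> as a flow on the legs.
\<close>

abbreviation "edge_flow \<equiv> \<lambda>a. cy S (fst a) (snd a)"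

lemma edge_flow_binary: "\<forall>a\<in>legs D. edge_flow a \<in> {0, 1}"
  using binary legs_props(1) unfolding compact_domain_def by fastforce

lemma leg_time:
  assumes "a \<in> legs D" "edge_flow a = 1"
  shows "t_stop S (fst a) + tt D (fst a) (snd a) \<le> t_stop S (snd a)"
    "t_stop S (fst a) < t_stop S (snd a)"
    "snd a \<notin> set (checkpoints D) \<Longrightarrow> t_stop S (snd a) = t_stop S (fst a) + tt D (fst a) (snd a)"
proof -
  have a: "fst a \<in> stations D" "snd a \<in> next_locs D (fst a)"
    using assms(1) legs_props(1) by (auto simp: next_locs_def)
  then have "t_stop S (fst a) + tt D (fst a) (snd a) - M_stop D * (1 - edge_flow a) \<le> t_stop S (snd a)"
    using constraints unfolding compact_constraints_def by blast
  then show le: "t_stop S (fst a) + tt D (fst a) (snd a) \<le> t_stop S (snd a)" using assms(2) by simp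
  have "0 < tt D (fst a) (snd a)" using valid assms(1) by (auto simp: valid_data_def)
  then show "t_stop S (fst a) < t_stop S (snd a)" using le by simp
  show "t_stop S (snd a) = t_stop S (fst a) + tt D (fst a) (snd a)" if "snd a \<notin> set (checkpoints D)"
    using rules a that assms(2) unfolding operating_rules_def by blast
qed

lemma edge_flow_ascending: "ascending (legs D) fst snd (t_stop S) edge_flow"
  using leg_time(2) edge_flow_binary unfolding ascending_def by fastforce

lemma edge_flow_flow: "flow (legs D) fst snd (origin D) (destination D) x edge_flow"
  unfolding flow_def
proof (intro conjI allI)
  show "\<forall>a\<in>legs D. 0 \<le> edge_flow a" using edge_flow_binary by fastforce
  fix i
  have "origin D \<in> stations D" "destination D \<in> stations D"
    using endpoints_in_checkpoints[OF valid] valid by (auto simp: valid_data_def)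
  moreover have "excess (legs D) fst snd edge_flow i = (if i = origin D then x else if i = destination D then - x else 0)"
    if "i \<in> stations D"
  proof -
    have "(\<Sum>j\<in>next_locs D i. cy S i j) - (\<Sum>j\<in>prev_locs D i. cy S j i)
        = (if i = origin D then x else if i = destination D then - x else 0)"
      using constraints that unfolding compact_constraints_def by blast
    then show ?thesis
      unfolding excess_def out_sum[OF legs_props(1), of "cy S" i] in_sum[OF legs_props(1), of "cy S" i] .
  qed
  moreover have "excess (legs D) fst snd edge_flow i = 0" if "i \<notin> stations D"
  proof -
    have "{a \<in> legs D. fst a = i} = {}" "{a \<in> legs D. snd a = i} = {}"
      using that legs_props(1) by auto
    then show ?thesis unfolding excess_def by (simp only: sum.empty)
  qed
  ultimately show "excess (legs D) fst snd edge_flow i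
      = (if i = origin D then x else if i = destination D then - x else 0)" by (cases "i \<in> stations D") auto
qed

lemma throughput_edges: "throughput D S i = (\<Sum>a\<in>{a \<in> legs D. fst a = i}. edge_flow a) + (\<Sum>a\<in>{a \<in> legs D. snd a = i}. edge_flow a)"
  using out_sum[OF legs_props(1), of "cy S" i] in_sum[OF legs_props(1), of "cy S" i]
  by (simp add: throughput_def)

lemma pick_locs_props:
  assumes "p \<in> requests D"
  shows "finite (pick_locs D p)" "pick_locs D p \<subseteq> stations D"
proof -
  show "pick_locs D p \<subseteq> stations D" using valid assms by (fastforce simp: valid_data_def)
  then show "finite (pick_locs D p)" using valid finite_subset by (auto simp: valid_data_def)
qed

lemma cw_binary: "p \<in> requests D \<Longrightarrow> i \<in> pick_locs D p \<Longrightarrow> cw S p i = 0 \<or> cw S p i = 1"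
  using binary pick_locs_props(2)[of p] unfolding compact_domain_def by blast

lemma cw_sum_le: "p \<in> requests D \<Longrightarrow> (\<Sum>i\<in>pick_locs D p. cw S p i) \<le> z p"
  using constraints by (simp add: compact_constraints_def)

lemma z_binary: "p \<in> requests D \<Longrightarrow> z p = 0 \<or> z p = 1"
  using first by (auto simp: first_stage_def)

lemma picked_compatible:
  assumes "p \<in> requests D" "i \<in> pick_locs D p" "cw S p i = 1"
  shows "compatible D p" "1 \<le> (\<Sum>i\<in>pick_locs D p. cw S p i)"
proof -
  have "cw S p i \<le> (\<Sum>i\<in>pick_locs D p. cw S p i)"
    using assms pick_locs_props(1) cw_binary by (intro member_le_sum) fastforce+
  then show "1 \<le> (\<Sum>i\<in>pick_locs D p. cw S p i)" using assms by simp
  then have "z p = 1" using cw_sum_le[OF assms(1)] z_binary[OF assms(1)] by auto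
  then show "compatible D p" using first assms(1) by (simp add: first_stage_def)
qed

lemma picked_unique:
  assumes "p \<in> requests D" "i \<in> pick_locs D p" "cw S p i = 1" "j \<in> pick_locs D p" "j \<noteq> i"
  shows "cw S p j = 0"
proof (rule ccontr)
  assume "cw S p j \<noteq> 0"
  then have "cw S p j = 1" using cw_binary assms by blast
  then have "(\<Sum>h\<in>{i, j}. cw S p h) = 2" using assms by simp
  moreover have "(\<Sum>h\<in>{i, j}. cw S p h) \<le> (\<Sum>h\<in>pick_locs D p. cw S p h)"
    using assms pick_locs_props(1) cw_binary by (intro sum_mono2) fastforce+
  ultimately show False using cw_sum_le[OF assms(1)] z_binary[OF assms(1)] by auto
qed

text \<open>
  The pickup plan of a subpath that is responsible for the locations \<open>W\<close>. The choice of the location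
  is unique, by \<open>picked_unique\<close>.
\<close>

definition pickups_within :: "'l set \<Rightarrow> 'p \<Rightarrow> ('l \<times> real) option" where
  "pickups_within W p = (if \<exists>i\<in>pick_locs D p \<inter> W. p \<in> requests D \<and> cw S p i = 1
     then let i = SOME i. i \<in> pick_locs D p \<inter> W \<and> cw S p i = 1 in Some (i, t_stop S i) else None)"

lemma pickups_within_Some:
  assumes "pickups_within W p = Some (i, t)"
  shows "p \<in> requests D" "i \<in> pick_locs D p" "i \<in> W" "cw S p i = 1" "t = t_stop S i"
proof -
  let ?i = "SOME i. i \<in> pick_locs D p \<inter> W \<and> cw S p i = 1"
  have ex: "p \<in> requests D" "\<exists>i. i \<in> pick_locs D p \<inter> W \<and> cw S p i = 1"
    using assms by (auto simp: pickups_within_def split: if_splits)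
  have "i = ?i" "t = t_stop S ?i"
    using assms by (auto simp: pickups_within_def Let_def split: if_splits)
  then show "p \<in> requests D" "i \<in> pick_locs D p" "i \<in> W" "cw S p i = 1" "t = t_stop S i"
    using someI_ex[OF ex(2)] ex(1) by auto
qed

lemma pickups_within_sum:
  assumes p: "p \<in> requests D"
  shows "(\<Sum>i\<in>pick_locs D p \<inter> W. cw S p i * g (i, t_stop S i))
    = (case pickups_within W p of None \<Rightarrow> 0 | Some s \<Rightarrow> (g s :: real))"
proof (cases "pickups_within W p")
  case None
  then have "\<forall>i\<in>pick_locs D p \<inter> W. cw S p i \<noteq> 1"
    using p by (auto simp: pickups_within_def Let_def split: if_splits)
  then have "\<forall>i\<in>pick_locs D p \<inter> W. cw S p i = 0" using cw_binary[OF p] by blast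
  then show ?thesis using None by simp
next
  case (Some s)
  obtain i t where s: "s = (i, t)" by (cases s)
  note i = pickups_within_Some[OF Some[unfolded s]]
  have "(\<Sum>j\<in>pick_locs D p \<inter> W. cw S p j * g (j, t_stop S j))
      = (\<Sum>j\<in>pick_locs D p \<inter> W. if j = i then g (i, t) else 0)"
    using picked_unique[OF i(1,2,4)] i by (intro sum.cong) auto
  then show ?thesis using Some s i pick_locs_props(1)[OF p] by simp
qed

lemma pickups_within_load:
  "real (\<Sum>p\<in>dom (pickups_within W). passengers D p) \<le> real (capacity D) * x"
proof -
  let ?w = "\<lambda>p. \<Sum>i\<in>pick_locs D p. cw S p i"
  have nonneg: "0 \<le> ?w p" if "p \<in> requests D" for p
    using cw_binary[OF that] by (intro sum_nonneg) force
  have "real (\<Sum>p\<in>dom (pickups_within W). passengers D p) \<le> (\<Sum>p\<in>dom (pickups_within W). real (passengers D p) * ?w p)"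
    unfolding of_nat_sum
  proof (rule sum_mono)
    fix p assume "p \<in> dom (pickups_within W)"
    then obtain i t where "pickups_within W p = Some (i, t)" by auto
    from pickups_within_Some[OF this] have "1 \<le> ?w p" by (intro picked_compatible(2))
    then show "real (passengers D p) \<le> real (passengers D p) * ?w p"
      by (metis mult.right_neutral mult_left_mono of_nat_0_le_iff)
  qed
  also have "\<dots> \<le> (\<Sum>p\<in>requests D. real (passengers D p) * ?w p)"
    using valid nonneg pickups_within_Some(1)
    by (intro sum_mono2) (auto simp: valid_data_def)
  also have "\<dots> \<le> real (capacity D) * x"
    using constraints by (simp add: compact_constraints_def sum_distrib_left)
  finally show ?thesis .
qed

end

text \<open>
  The case \<open>x = 1\<close>, together with the walk \<open>es\<close> formed by the legs that the vehicle uses.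
\<close>

locale running_trip = compact_trip D 1 z S for D :: "('l, 'p) trip_data" and z S +
  fixes es
  assumes es_walk: "walk fst snd (origin D) es (destination D)" and es_legs: "set es \<subseteq> legs D"
    and es_flow: "\<forall>a\<in>legs D. edge_flow a = real (count_list es a)"
begin

lemma es_one: "a \<in> set es \<Longrightarrow> edge_flow a = 1"
  using es_flow es_legs edge_flow_binary count_list_0_iff[of es a] by fastforce

lemma es_time:
  assumes "a \<in> set es"
  shows "t_stop S (fst a) + tt D (fst a) (snd a) \<le> t_stop S (snd a)"
    "t_stop S (fst a) < t_stop S (snd a)"
    "snd a \<notin> set (checkpoints D) \<Longrightarrow> t_stop S (snd a) = t_stop S (fst a) + tt D (fst a) (snd a)"
  using leg_time[of a] es_one es_legs assms by auto

lemma throughput_es: "throughput D S i = real (degree i es)"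
proof -
  have "(\<Sum>a\<in>{a \<in> legs D. Q a}. edge_flow a) = (\<Sum>a\<in>{a \<in> legs D. Q a}. real (count_list es a))" for Q
    using es_flow by (intro sum.cong) auto
  then show ?thesis
    by (simp only: throughput_edges degree_def sum_count_list_length[OF legs_props(2) es_legs] of_nat_add)
qed

lemma visited_time: "i \<in> set (checkpoints D) \<Longrightarrow> 1 \<le> degree i es \<Longrightarrow> t_stop S i = sched D i"
  using rules throughput_es by (simp add: operating_rules_def)

lemma window_visited:
  assumes "n + max_skip D < length (checkpoints D)"
  shows "\<exists>m\<in>{n..n + max_skip D}. 1 \<le> degree (checkpoints D ! m) es"
proof (rule ccontr)
  assume none: "\<not> ?thesis"
  have "cv S (checkpoints D ! m) \<le> 0" if "m \<in> {n..n + max_skip D}" for m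
  proof -
    have "checkpoints D ! m \<in> set (checkpoints D)" using that assms by simp
    then have "cv S (checkpoints D ! m) \<le> throughput D S (checkpoints D ! m)"
      using constraints unfolding compact_constraints_def by blast
    moreover have "\<not> 1 \<le> degree (checkpoints D ! m) es" using none that by blast
    then have "degree (checkpoints D ! m) es = 0" by simp
    ultimately show ?thesis by (simp add: throughput_es)
  qed
  then have "(\<Sum>m = n..n + max_skip D. cv S (checkpoints D ! m)) \<le> 0" by (rule sum_nonpos)
  moreover have "1 \<le> (\<Sum>m = n..n + max_skip D. cv S (checkpoints D ! m))"
    using constraints assms unfolding compact_constraints_def by blast
  ultimately show False by simp
qed

text \<open>
  The part of the walk between two consecutive visited checkpoints \<open>k\<close> and \<open>c\<close> is the route of a
  subpath. The assumption \<open>between\<close> says that no checkpoint is visited between them in time; with the window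
  constraints it bounds the number of skipped checkpoints.
\<close>

lemma segment_subpath:
  assumes seg: "walk fst snd k (seg @ [a]) c" "set (seg @ [a]) \<subseteq> set es"
    and k: "k \<in> set (checkpoints D)" and c: "c \<in> set (checkpoints D)"
    and inner: "\<forall>b\<in>set seg. snd b \<notin> set (checkpoints D)"
    and between: "\<forall>i\<in>set (checkpoints D). 1 \<le> degree i es \<longrightarrow> t_stop S i \<le> t_stop S k \<or> t_stop S c \<le> t_stop S i"
    and W: "W \<subseteq> insert k (snd ` set (seg @ [a]))"
  shows "Subpath (map (\<lambda>i. (i, t_stop S i)) (k # map snd (seg @ [a]))) (pickups_within W) \<in> subpaths D"
    (is "?r \<in> _")
proof -
  let ?P = "seg @ [a]" and ?ks = "k # map snd (seg @ [a])" and ?C = "set (checkpoints D)"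
  have locs: "sp_locs ?r = ?ks" by (simp add: sp_locs_def o_def)
  have ac: "snd a = c" using seg(1) by (auto simp: walk_append)
  have ends: "sp_start ?r = k" "sp_end ?r = c"
    unfolding sp_start_def sp_end_def locs using ac by simp_all
  have nth: "?P ! h = (?ks ! h, ?ks ! Suc h)" if "h < length ?P" for h
    using nth_adj[of h ?ks] adj_walk[OF seg(1)] that by simp
  have es: "?P ! h \<in> set es" if "h < length ?P" for h using seg(2) nth_mem[OF that] by blast
  have edge: "(?ks ! h, ?ks ! Suc h) \<in> set es" if "h < length ?P" for h using nth es that by metis
  have kc: "t_stop S k < t_stop S c"
    using walk_distinct[OF seg(1), of "t_stop S"] es_time(2) seg(2) by blast
  have "1 \<le> degree k es"
    unfolding degree_pos_iff using edge[of 0] by (intro bexI[of _ "(?ks ! 0, ?ks ! Suc 0)"]) simp_all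
  moreover have "1 \<le> degree c es"
    unfolding degree_pos_iff using ac seg(2) by (intro bexI[of _ a]) simp_all
  ultimately have tk: "t_stop S k = sched D k" "t_stop S c = sched D c" using visited_time k c by auto
  obtain m n where mn: "checkpoints D ! m = k" "m < length (checkpoints D)"
    "checkpoints D ! n = c" "n < length (checkpoints D)" using k c by (metis in_set_conv_nth)
  have "m < n"
    using checkpoint_nth_less[OF valid, of n m] mn kc tk by (metis less_asym less_irrefl linorder_neqE_nat)
  moreover have "n - m - 1 \<le> max_skip D"
  proof (rule ccontr)
    assume "\<not> n - m - 1 \<le> max_skip D"
    \<comment> \<open>Otherwise a whole window lies strictly between the two checkpoints, and the checkpoint visited
       in it would be served at a time strictly between theirs.\<close>
    then have "Suc m + max_skip D < n" by simp
    then obtain h where h: "h \<in> {Suc m..Suc m + max_skip D}" "1 \<le> degree (checkpoints D ! h) es"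
      using window_visited[of "Suc m"] mn by auto
    then have "m < h" "h < n" "checkpoints D ! h \<in> ?C" using \<open>Suc m + max_skip D < n\<close> mn by auto
    then show False
      using between h(2) visited_time checkpoint_nth_less[OF valid, of m h]
        checkpoint_nth_less[OF valid, of h n] mn tk by fastforce
  qed
  ultimately have idx: "\<exists>a b. a < b \<and> b < length (checkpoints D) \<and> b - a - 1 \<le> max_skip D \<and>
        sp_start ?r = checkpoints D ! a \<and> sp_end ?r = checkpoints D ! b"
    using mn ends by metis
  have stations: "set ?ks \<subseteq> stations D"
  proof -
    have "snd b \<in> stations D" if "b \<in> set ?P" for b
      using that seg(2) es_legs legs_props(1) by (metis mem_Sigma_iff prod.collapse subsetD)
    moreover have "k \<in> stations D" using k valid by (auto simp: valid_data_def)
    ultimately show ?thesis by auto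
  qed
  have 1: "\<forall>h. Suc h < length (route ?r) \<longrightarrow> sp_locs ?r ! Suc h \<in> next_locs D (sp_locs ?r ! h)"
    using edge es_legs legs_props(1) unfolding locs next_locs_def by fastforce
  have 2: "\<forall>i\<in>set (sp_locs ?r). i \<in> stations D \<and> ref_dist D i \<le> max_dist D"
    using stations valid unfolding locs valid_data_def by blast
  have inner_h: "?ks ! h \<notin> ?C" if "0 < h" "h < length ?P" for h
  proof -
    have "?ks ! h = snd (seg ! (h - 1))" using that by (cases h) (auto simp: nth_append)
    then show ?thesis using inner that by auto
  qed
  then have 3: "\<forall>h. 0 < h \<and> Suc h < length (route ?r) \<longrightarrow> sp_locs ?r ! h \<notin> ?C"
    unfolding locs by simp
  have snd_route: "snd (route ?r ! h) = t_stop S (?ks ! h)" if "h < length ?ks" for h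
    using that by (simp del: list.map)
  have 4: "\<forall>h. Suc (Suc h) < length (route ?r) \<longrightarrow>
        snd (route ?r ! Suc h) = snd (route ?r ! h) + tt D (sp_locs ?r ! h) (sp_locs ?r ! Suc h)"
  proof (intro allI impI)
    fix h assume "Suc (Suc h) < length (route ?r)"
    then have h: "Suc h < length ?P" by simp
    then show "snd (route ?r ! Suc h) = snd (route ?r ! h) + tt D (sp_locs ?r ! h) (sp_locs ?r ! Suc h)"
      unfolding locs using es_time(3)[OF edge[of h]] inner_h[of "Suc h"] snd_route[of h] snd_route[of "Suc h"]
      by simp
  qed
  have 5: "travel_time D (sp_locs ?r) \<le> sched D (sp_end ?r) - sched D (sp_start ?r)"
    unfolding locs ends using travel_time_walk[OF seg(1), of "t_stop S"] es_time(1) seg(2) tk by auto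
  have 6: "served ?r \<subseteq> {p \<in> requests D. compatible D p}"
    using pickups_within_Some picked_compatible(1) by (fastforce simp: served_def)
  have 7: "load D ?r \<le> capacity D"
    using pickups_within_load[of W] unfolding mult_1_right of_nat_le_iff by (simp add: load_def served_def)
  have 8: "(i, t) \<in> set (route ?r) \<and> i \<in> pick_locs D p \<and> acceptable D p i t"
    if "pickup ?r p = Some (i, t)" for p i t
  proof -
    have pk: "pickups_within W p = Some (i, t)" using that by simp
    note i = pickups_within_Some[OF pk]
    have "i \<in> set ?ks" using i(3) W by auto
    moreover have "acceptable D p i (t_stop S i)"
      using rules i unfolding operating_rules_def by blast
    ultimately show ?thesis using i by (auto simp del: list.map)
  qed
  have 9: "2 \<le> length (route ?r)" "snd (hd (route ?r)) = sched D (sp_start ?r)"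
    "snd (last (route ?r)) = sched D (sp_end ?r)"
    unfolding ends using tk ac by (simp_all add: last_map)
  show ?thesis
    unfolding subpaths_def mem_Collect_eq using idx 1 2 3 4 5 6 7 8 9 by blast
qed

text \<open>
  Induction along the walk, cutting at the next checkpoint. Each subpath is responsible for the pickups at all
  its stops but the first, so that a checkpoint shared by two subpaths is not served
  twice. The set \<open>X\<close> adds the starting checkpoint back for the first subpath of the trip.
\<close>

lemma split_at_checkpoints:
  assumes "walk fst snd k P (destination D)" "set P \<subseteq> set es" "k \<in> set (checkpoints D)"
    "\<forall>i\<in>set (checkpoints D). 1 \<le> degree i es \<longrightarrow> t_stop S i \<le> t_stop S k \<or> i \<in> snd ` set P"
    "X \<subseteq> {k}" "P = [] \<Longrightarrow> X = {}"
  shows "\<exists>rs. set rs \<subseteq> subpaths D \<and> walk sp_start sp_end k rs (destination D) \<and>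
    (\<forall>p\<in>requests D. \<forall>g. pickup_total g p rs
       = (\<Sum>i\<in>pick_locs D p \<inter> (X \<union> snd ` set P). cw S p i * g (i, t_stop S i)))"
  using assms
proof (induction "length P" arbitrary: P k X rule: less_induct)
  case less
  show ?case
  proof (cases "P = []")
    case True
    then show ?thesis using less.prems by (intro exI[of _ "[]"]) simp
  next
    case False
    have "snd (last P) = destination D" using less.prems(1) False by (auto simp: walk_iff)
    then have "\<exists>a\<in>set P. snd a \<in> set (checkpoints D)"
      using False endpoints_in_checkpoints(2)[OF valid] by (metis last_in_set)
    then obtain seg a Q where P: "P = seg @ a # Q" "snd a \<in> set (checkpoints D)"
      "\<forall>b\<in>set seg. snd b \<notin> set (checkpoints D)"
      using split_list_first_prop[of P "\<lambda>a. snd a \<in> set (checkpoints D)"] by metis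
    have w: "walk fst snd k (seg @ [a]) (snd a)" "walk fst snd (snd a) Q (destination D)"
      using less.prems(1) P(1) by (auto simp: walk_append)
    have sub: "set (seg @ [a]) \<subseteq> set es" "set Q \<subseteq> set es" using less.prems(2) P(1) by auto
    have inc: "t_stop S (fst b) < t_stop S (snd b)" if "b \<in> set P" for b
      using es_time(2) less.prems(2) that by blast
    have "sorted_wrt (\<lambda>i j. t_stop S i < t_stop S j) (k # map snd P)"
      by (rule walk_stops_sorted[OF less.prems(1)]) (rule inc)
    then have s: "\<forall>i\<in>insert k (snd ` set seg). t_stop S i < t_stop S (snd a)" "t_stop S k < t_stop S (snd a)"
      "\<forall>j\<in>snd ` set Q. t_stop S (snd a) < t_stop S j"
      unfolding P(1) by (auto simp: sorted_wrt_append)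
    define W where "W = X \<union> snd ` set (seg @ [a])"
    have le: "\<forall>i\<in>W. t_stop S i \<le> t_stop S (snd a)"
      using s less.prems(5) by (auto simp: W_def less_imp_le)
    define r where "r = Subpath (map (\<lambda>i. (i, t_stop S i)) (k # map snd (seg @ [a]))) (pickups_within W)"
    have r: "r \<in> subpaths D"
      unfolding r_def
    proof (rule segment_subpath[OF w(1) sub(1) less.prems(3) P(2,3)])
      show "\<forall>i\<in>set (checkpoints D). 1 \<le> degree i es \<longrightarrow> t_stop S i \<le> t_stop S k \<or> t_stop S (snd a) \<le> t_stop S i"
      proof (intro ballI impI)
        fix i assume i: "i \<in> set (checkpoints D)" "1 \<le> degree i es"
        then have "t_stop S i \<le> t_stop S k \<or> i = snd a \<or> i \<in> snd ` set Q"
          using less.prems(4) P(1,3) by auto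
        then show "t_stop S i \<le> t_stop S k \<or> t_stop S (snd a) \<le> t_stop S i"
          using s(3) by (auto simp: less_imp_le)
      qed
      show "W \<subseteq> insert k (snd ` set (seg @ [a]))" using less.prems(5) by (auto simp: W_def)
    qed
    have ends: "sp_start r = k" "sp_end r = snd a"
      by (simp_all add: r_def sp_start_def sp_end_def sp_locs_def)
    have "\<exists>rs. set rs \<subseteq> subpaths D \<and> walk sp_start sp_end (snd a) rs (destination D) \<and>
      (\<forall>p\<in>requests D. \<forall>g. pickup_total g p rs
         = (\<Sum>i\<in>pick_locs D p \<inter> ({} \<union> snd ` set Q). cw S p i * g (i, t_stop S i)))"
    proof (rule less.hyps[OF _ w(2) sub(2) P(2)])
      show "length Q < length P" using P(1) by simp
      show "\<forall>i\<in>set (checkpoints D). 1 \<le> degree i es \<longrightarrow> t_stop S i \<le> t_stop S (snd a) \<or> i \<in> snd ` set Q"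
      proof (intro ballI impI)
        fix i assume i: "i \<in> set (checkpoints D)" "1 \<le> degree i es"
        then have "t_stop S i \<le> t_stop S k \<or> i = snd a \<or> i \<in> snd ` set Q"
          using less.prems(4) P(1,3) by auto
        then show "t_stop S i \<le> t_stop S (snd a) \<or> i \<in> snd ` set Q"
          using s(2) by auto
      qed
    qed simp_all
    then obtain rs where rs: "set rs \<subseteq> subpaths D" "walk sp_start sp_end (snd a) rs (destination D)"
      "\<And>p g. p \<in> requests D \<Longrightarrow> pickup_total g p rs
         = (\<Sum>i\<in>pick_locs D p \<inter> snd ` set Q. cw S p i * g (i, t_stop S i))"
      by auto
    have "pickup_total g p (r # rs) = (\<Sum>i\<in>pick_locs D p \<inter> (X \<union> snd ` set P). cw S p i * g (i, t_stop S i))"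
      if p: "p \<in> requests D" for p g
    proof -
      have split: "pick_locs D p \<inter> (X \<union> snd ` set P) = pick_locs D p \<inter> W \<union> pick_locs D p \<inter> snd ` set Q"
        by (auto simp: P(1) W_def)
      have "(pick_locs D p \<inter> W) \<inter> (pick_locs D p \<inter> snd ` set Q) = {}"
        using le s(3) by (meson disjoint_iff IntD2 not_less)
      then have "(\<Sum>i\<in>pick_locs D p \<inter> (X \<union> snd ` set P). cw S p i * g (i, t_stop S i))
          = (\<Sum>i\<in>pick_locs D p \<inter> W. cw S p i * g (i, t_stop S i))
            + (\<Sum>i\<in>pick_locs D p \<inter> snd ` set Q. cw S p i * g (i, t_stop S i))"
        unfolding split using pick_locs_props(1)[OF p] by (intro sum.union_disjoint) auto
      then show ?thesis
        using rs(3)[OF p, of g] pickups_within_sum[OF p, where W = W and g = g] by (simp add: pickup_total_Cons r_def)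
    qed
    then show ?thesis using r ends rs(1,2) by (intro exI[of _ "r # rs"]) auto
  qed
qed

lemma visited_iff: "1 \<le> degree i es \<longleftrightarrow> i \<in> insert (origin D) (snd ` set es)"
proof -
  have ne: "es \<noteq> []" using es_walk origin_neq_destination[OF valid] by auto
  have "2 \<le> length (origin D # map snd es)" using ne by (cases es) auto
  from degree_adj[OF this, of i] show ?thesis
    unfolding adj_walk[OF es_walk] by (cases "i \<in> insert (origin D) (snd ` set es)") auto
qed

lemma pickup_visited:
  assumes "p \<in> requests D" "i \<in> pick_locs D p" "i \<notin> insert (origin D) (snd ` set es)"
  shows "cw S p i = 0"
proof -
  have "cw S p i \<le> throughput D S i" using constraints assms unfolding compact_constraints_def by blast
  moreover have "degree i es = 0" using visited_iff[of i] assms(3) by linarith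
  ultimately show ?thesis using cw_binary[OF assms(1,2)] by (simp add: throughput_es)
qed

text \<open>
  Since a pickup requires a visit, the pickups at the stops of the walk are all the pickups.
\<close>

lemma compact_to_trip:
  "\<exists>rs. is_trip D rs \<and> (\<forall>p\<in>requests D. \<forall>g. pickup_total g p rs
     = (\<Sum>i\<in>pick_locs D p. cw S p i * g (i, t_stop S i)))"
proof -
  have ne: "es \<noteq> []" using es_walk origin_neq_destination[OF valid] by auto
  have "\<exists>rs. set rs \<subseteq> subpaths D \<and> walk sp_start sp_end (origin D) rs (destination D) \<and>
    (\<forall>p\<in>requests D. \<forall>g. pickup_total g p rs
       = (\<Sum>i\<in>pick_locs D p \<inter> ({origin D} \<union> snd ` set es). cw S p i * g (i, t_stop S i)))"
    using visited_iff ne endpoints_in_checkpoints[OF valid]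
    by (intro split_at_checkpoints[OF es_walk]) auto
  then obtain rs where rs: "set rs \<subseteq> subpaths D" "walk sp_start sp_end (origin D) rs (destination D)"
    "\<And>p g. p \<in> requests D \<Longrightarrow> pickup_total g p rs
       = (\<Sum>i\<in>pick_locs D p \<inter> ({origin D} \<union> snd ` set es). cw S p i * g (i, t_stop S i))" by blast
  have eq: "pickup_total g p rs = (\<Sum>i\<in>pick_locs D p. cw S p i * g (i, t_stop S i))"
    if p: "p \<in> requests D" for p g
    unfolding rs(3)[OF p] using pickup_visited[OF p] pick_locs_props(1)[OF p]
    by (intro sum.mono_neutral_left) auto
  have "real (\<Sum>r\<leftarrow>rs. load D r) = (\<Sum>p\<in>requests D. real (passengers D p) * pickup_total (\<lambda>_. 1) p rs)"
    by (simp add: trip_load[OF valid rs(1)] pickup_total_one)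
  also have "\<dots> = (\<Sum>p\<in>requests D. \<Sum>i\<in>pick_locs D p. real (passengers D p) * cw S p i)"
    by (intro sum.cong refl) (simp add: eq sum_distrib_left)
  also have "\<dots> \<le> real (capacity D) * 1" using constraints unfolding compact_constraints_def by blast
  finally have "(\<Sum>r\<leftarrow>rs. load D r) \<le> capacity D" by simp
  then show ?thesis using rs eq by (intro exI[of _ rs]) (simp add: is_trip_iff[OF valid])
qed

end

section \<open>Optimal compact solutions\<close>

text \<open>
  Constraints bound pickup times from below only, so a pickup may be delayed by any amount.
\<close>

lemma (in compact_trip) delayed_pickup:
  fixes q :: 'p
  assumes "0 \<le> e"
  defines "S' \<equiv> S\<lparr>t_pick := (t_pick S)(q := t_pick S q + e)\<rparr>"
  shows "compact_feasible D x z S'" "operating_rules D S'"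
    "q \<in> requests D \<Longrightarrow>
      compact_cost D S' = compact_cost D S + real (passengers D q) * time_rate D q * e"
proof -
  have thr: "throughput D S' i = throughput D S i" for i by (simp add: S'_def throughput_def)
  have "t_pick S p \<le> t_pick S' p" for p using assms(1) by (simp add: S'_def)
  then have up: "u \<le> t_pick S p \<Longrightarrow> u \<le> t_pick S' p" for u p using order_trans by blast
  have "compact_constraints D x z S'"
    using constraints up unfolding compact_constraints_def thr by (simp add: S'_def)
  moreover have "compact_domain D {0, 1} S'" using binary by (simp add: compact_domain_def S'_def)
  ultimately show "compact_feasible D x z S'" by (simp add: compact_feasible_def)
  show "operating_rules D S'" using rules unfolding operating_rules_def thr by (simp add: S'_def)
  assume q: "q \<in> requests D"
  have "compact_cost D S' = (\<Sum>p\<in>requests D. real (passengers D p) *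
      ((\<Sum>i\<in>pick_locs D p. assign_rate D p i * cw S p i) + time_rate D p * t_pick S p)
      + (if p = q then real (passengers D q) * time_rate D q * e else 0))"
    unfolding compact_cost_rates by (intro sum.cong) (auto simp: S'_def algebra_simps)
  also have "\<dots> = compact_cost D S + real (passengers D q) * time_rate D q * e"
    using q valid by (simp add: compact_cost_rates sum.distrib valid_data_def)
  finally show "compact_cost D S' = compact_cost D S + real (passengers D q) * time_rate D q * e" .
qed

lemma (in compact_trip) time_rate_nonneg:
  assumes opt: "\<And>S'. compact_feasible D x z S' \<Longrightarrow> operating_rules D S' \<Longrightarrow> compact_cost D S \<le> compact_cost D S'"
    and p: "p \<in> requests D"
  shows "0 \<le> real (passengers D p) * time_rate D p"
  using opt[OF delayed_pickup(1,2), of 1 p] delayed_pickup(3)[OF _ p, of 1] by simp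

lemma (in compact_trip) t_pick_lower:
  assumes p: "p \<in> requests D"
  shows "(\<Sum>i\<in>pick_locs D p. cw S p i * t_stop S i) \<le> t_pick S p"
proof (cases "\<exists>i\<in>pick_locs D p. cw S p i = 1")
  case True
  then obtain i where i: "i \<in> pick_locs D p" "cw S p i = 1" by blast
  have "(\<Sum>j\<in>pick_locs D p. cw S p j * t_stop S j) = (\<Sum>j\<in>pick_locs D p. if j = i then t_stop S i else 0)"
    using picked_unique[OF p i] i by (intro sum.cong) auto
  also have "\<dots> = t_stop S i" using i pick_locs_props(1)[OF p] by simp
  also have "t_stop S i - M_stop D * (1 - cw S p i) \<le> t_pick S p"
    using constraints p i pick_locs_props(2)[OF p] unfolding compact_constraints_def by blast
  then have "t_stop S i \<le> t_pick S p" using i by simp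
  finally show ?thesis .
next
  case False
  then have "(\<Sum>i\<in>pick_locs D p. cw S p i * t_stop S i) = 0" using cw_binary[OF p] by (intro sum.neutral) auto
  moreover have "0 \<le> t_pick S p" using constraints p by (simp add: compact_constraints_def)
  ultimately show ?thesis by simp
qed

lemma (in compact_trip) idle_trip_picks_nobody:
  assumes "x = 0" "p \<in> requests D" "i \<in> pick_locs D p"
  shows "cw S p i = 0"
proof -
  have idle: "edge_flow a = 0" if "a \<in> legs D" for a
    using zero_flow[OF legs_props(2) edge_flow_flow[unfolded assms(1)] edge_flow_ascending that] .
  have "throughput D S i = 0"
  proof -
    have "(\<Sum>a\<in>{a \<in> legs D. Q a}. edge_flow a) = 0" for Q
      by (rule sum.neutral) (use idle in blast)
    then show ?thesis by (simp only: throughput_edges add_0_left)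
  qed
  moreover have "cw S p i \<le> throughput D S i"
    using constraints assms unfolding compact_constraints_def by blast
  ultimately show ?thesis using cw_binary[OF assms(2,3)] by auto
qed

text \<open>
  The network solution has the cost that the compact solution would have if every request were
  picked up at the stop time of its location.
\<close>

lemma (in compact_trip) network_of_compact:
  shows "\<exists>y. network_feasible D x z y \<and> network_cost D y =
    (\<Sum>p\<in>requests D. real (passengers D p) * ((\<Sum>i\<in>pick_locs D p. assign_rate D p i * cw S p i)
      + time_rate D p * (\<Sum>i\<in>pick_locs D p. cw S p i * t_stop S i)))"
proof -
  consider "x = 0" | "x = 1" using first by (auto simp: first_stage_def)
  then show ?thesis
  proof cases
    case 1
    have "network_feasible D x z (\<lambda>_. 0)"
      using 1 z_binary by (fastforce simp: network_feasible_def network_constraints_def)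
    moreover have "network_cost D (\<lambda>_. 0) = 0" by (simp add: network_cost_def)
    ultimately show ?thesis
      using idle_trip_picks_nobody[OF 1] by (intro exI[of _ "\<lambda>_. 0"]) (simp add: sum.neutral)
  next
    case 2
    obtain es where "walk fst snd (origin D) es (destination D)" "set es \<subseteq> legs D" "distinct es"
      "\<forall>a\<in>legs D. edge_flow a = real (count_list es a)"
      using binary_flow[OF legs_props(2) edge_flow_flow[unfolded 2] edge_flow_ascending
          origin_neq_destination[OF valid] edge_flow_binary] by metis
    then have "running_trip D z S es"
      using valid first feasible rules 2 by unfold_locales auto
    from running_trip.compact_to_trip[OF this] obtain rs where rs: "is_trip D rs"
      "\<And>p g. p \<in> requests D \<Longrightarrow> pickup_total g p rs = (\<Sum>i\<in>pick_locs D p. cw S p i * g (i, t_stop S i))"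
      by blast
    have "real (times_served p rs) \<le> z p" if "p \<in> requests D" for p
      using cw_sum_le[OF that] rs(2)[OF that, of "\<lambda>_. 1"] by (simp add: pickup_total_one)
    from trip_network_feasible[OF valid rs(1) this] obtain y
      where y: "network_feasible D 1 z y" "network_cost D y = (\<Sum>r\<leftarrow>rs. subpath_cost D r)" by blast
    have sub: "set rs \<subseteq> subpaths D" using rs(1) by (simp add: is_trip_def)
    have "network_cost D y = (\<Sum>p\<in>requests D. real (passengers D p) * ((\<Sum>i\<in>pick_locs D p. assign_rate D p i * cw S p i)
      + time_rate D p * (\<Sum>i\<in>pick_locs D p. cw S p i * t_stop S i)))"
      unfolding y(2) trip_cost[OF valid sub]
      by (intro sum.cong refl arg_cong2[where f = "(*)"])
        (simp add: rs(2) pickup_cost_rates distrib_left sum.distrib sum_distrib_left mult_ac)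
    then show ?thesis using y(1) 2 by blast
  qed
qed

lemma compact_to_network:
  assumes V: "valid_data D" and M: "valid_big_M D" and fs: "first_stage D x z" and once: "visits_once D"
    and S: "is_arg_min (compact_cost D) (\<lambda>S. compact_feasible D x z S \<and> operating_rules D S) S"
  shows "\<exists>y. network_feasible D x z y \<and> network_cost D y = compact_cost D S"
proof -
  interpret compact_trip D x z S
    using V fs S by unfold_locales (auto simp: is_arg_min_def)
  have opt: "compact_cost D S \<le> compact_cost D S'" if "compact_feasible D x z S'" "operating_rules D S'" for S'
    using S that by (auto simp: is_arg_min_def not_less)
  obtain y where y: "network_feasible D x z y" "network_cost D y =
    (\<Sum>p\<in>requests D. real (passengers D p) * ((\<Sum>i\<in>pick_locs D p. assign_rate D p i * cw S p i)
      + time_rate D p * (\<Sum>i\<in>pick_locs D p. cw S p i * t_stop S i)))"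
    using network_of_compact by blast
  have "network_cost D y \<le> compact_cost D S"
    unfolding y(2) compact_cost_rates
  proof (rule sum_mono)
    fix p assume p: "p \<in> requests D"
    \<comment> \<open>At a negative rate, delaying the pickup would contradict optimality.\<close>
    have "0 \<le> real (passengers D p) * time_rate D p" by (rule time_rate_nonneg[OF opt p])
    from mult_left_mono[OF t_pick_lower[OF p] this]
    show "real (passengers D p) * ((\<Sum>i\<in>pick_locs D p. assign_rate D p i * cw S p i)
        + time_rate D p * (\<Sum>i\<in>pick_locs D p. cw S p i * t_stop S i))
      \<le> real (passengers D p) * ((\<Sum>i\<in>pick_locs D p. assign_rate D p i * cw S p i) + time_rate D p * t_pick S p)"
      by (simp add: distrib_left mult.assoc)
  qed
  moreover obtain S' where "compact_feasible D x z S'" "operating_rules D S'" "compact_cost D S' = network_cost D y"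
    using network_to_compact[OF V M fs once y(1)] by blast
  ultimately show ?thesis using opt[of S'] y(1) by (intro exI[of _ y]) auto
qed

theorem proposition1:
  fixes D :: "('l, 'p) trip_data" and x :: real and z :: "'p \<Rightarrow> real"
  assumes "valid_data D" and "valid_big_M D" and "first_stage D x z" and "visits_once D"
  shows "(\<forall>S. is_arg_min (compact_cost D) (\<lambda>S. compact_feasible D x z S \<and> operating_rules D S) S \<longrightarrow>
            (\<exists>y. network_feasible D x z y \<and> network_cost D y = compact_cost D S)) \<and>
         (\<forall>y. is_arg_min (network_cost D) (network_feasible D x z) y \<longrightarrow>
            (\<exists>S. compact_feasible D x z S \<and> operating_rules D S \<and>
                 compact_cost D S = network_cost D y)) \<and>
         compact_lp_value D x z \<le> network_lp_value D x z"
  using compact_to_network[OF assms] network_to_compact[OF assms] lp_value_le[OF assms]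
  by (auto simp: is_arg_min_def)

end
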